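(* Let $\kappa$ be a regular uncountable cardinal and $\lambda \geq \kappa$ a cardinal. Suppose that $\kappa$ is mildly $\lambda$-ineffable and $\mathrm{cf}(\lambda) \neq \kappa$. Then $\mathrm{cov}(\lambda, \kappa^+, \kappa^+, \kappa) = \lambda$.
   Context: For a set $A$ and a cardinal $\tau$, $P_\tau(A) = \{a \subseteq A : |a| < \tau\}$. $\kappa$ is mildly $\lambda$-ineffable if, given $s_a \subseteq a$ for $a \in P_\kappa(\lambda)$, there exists $S \subseteq \lambda$ such that for any $b \in P_\kappa(\lambda)$ there is $a \in P_\kappa(\lambda)$ with $b \subseteq a$ and $S \cap b = s_a \cap b$. Given four cardinals $\rho_1 \geq \rho_2 \geq \rho_3 \geq \omega$ and $\rho_3 \geq \rho_4 \geq 2$, $\mathrm{cov}(\rho_1,\rho_2,\rho_3,\rho_4)$ denotes the least cardinality of any $X \subseteq P_{\rho_2}(\rho_1)$ such that for any $a \in P_{\rho_3}(\rho_1)$ there is $Q \in P_{\rho_4}(X)$ with $a \subseteq \bigcup Q$. *)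

theory Defs
  imports Main
begin

unbundle cardinal_syntax

text \<open>
  Cardinals are the library's cardinal orders (\<open>Card_order r\<close>), compared up to order isomorphism
  (\<open>=o\<close>, \<open>\<le>o\<close>, \<open><o\<close>).  The cardinal \<open>r\<close>, viewed as a set, is \<open>Field r\<close>.
\<close>

definition P_less :: "'b rel \<Rightarrow> 'a set \<Rightarrow> 'a set set" where
  "P_less t A = {a. a \<subseteq> A \<and> |a| <o t}"

text \<open>The least cardinality of a member of \<open>F\<close>; meaningful for \<open>F \<noteq> {}\<close> only.\<close>

definition least_card :: "'a set set \<Rightarrow> 'a rel" where
  "least_card F = |SOME A. A \<in> F \<and> (\<forall>B\<in>F. |A| \<le>o |B| )|"

lemma least_card:
  assumes "F \<noteq> {}"
  shows "\<exists>A\<in>F. least_card F = |A|" and "\<forall>B\<in>F. least_card F \<le>o |B|"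
proof -
  have "\<exists>A. A \<in> F \<and> (\<forall>B\<in>F. |A| \<le>o |B| )"
    using exists_minim_Card_order[of "card_of ` F"] assms by (auto simp: card_of_Card_order)
  from someI_ex[OF this]
  show "\<exists>A\<in>F. least_card F = |A|" "\<forall>B\<in>F. least_card F \<le>o |B|"
    unfolding least_card_def by blast+
qed

text \<open>
  The library's \<open>cofinal A r\<close> asks for a strictly larger element of \<open>A\<close> above each point; for
  infinite cardinals (which are limit orders) this is the usual notion, and cofinality is
  used for these only.
\<close>

definition cofinality :: "'a rel \<Rightarrow> 'a rel" where
  "cofinality r = least_card {A. A \<subseteq> Field r \<and> cofinal A r}"

definition mildly_ineffable :: "'b rel \<Rightarrow> 'a rel \<Rightarrow> bool" where
  "mildly_ineffable k l \<longleftrightarrow>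
     (\<forall>s :: 'a set \<Rightarrow> 'a set. (\<forall>a \<in> P_less k (Field l). s a \<subseteq> a) \<longrightarrow>
       (\<exists>S. S \<subseteq> Field l \<and>
         (\<forall>b \<in> P_less k (Field l). \<exists>a \<in> P_less k (Field l). b \<subseteq> a \<and> S \<inter> b = s a \<inter> b)))"

text \<open>
  To be used for \<open>r1 \<ge> r2 \<ge> r3 \<ge> \<omega>\<close> and \<open>r3 \<ge> r4 \<ge> 2\<close>.
\<close>

definition cov :: "'a rel \<Rightarrow> 'b rel \<Rightarrow> 'c rel \<Rightarrow> 'd rel \<Rightarrow> 'a set rel" where
  "cov r1 r2 r3 r4 = least_card
     {X. X \<subseteq> P_less r2 (Field r1) \<and>
         (\<forall>a \<in> P_less r3 (Field r1). \<exists>Q \<in> P_less r4 X. a \<subseteq> \<Union>Q)}"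

end

theory Submission
  imports Defs
begin

text \<open>
  By induction on the cardinality of \<open>A\<close>, with \<open>|A|\<^sup>+ \<le> l\<close>, the subsets of \<open>A\<close> of size at most \<open>k\<close> are
  covered, in the sense of \<open>cov\<close>, by a family of at most \<open>|A|\<^sup>+\<close> sets.  If the cofinality of \<open>|A|\<close>
  is not \<open>k\<close>, the families of the initial segments can be put together, and \<open>|A|\<close> sets suffice;
  this also settles the case of \<open>l\<close> itself.  If \<open>m = |A| > k\<close> has cofinality \<open>k\<close>, write \<open>m\<close> as
  an increasing union of \<open>k\<close> pieces \<open>U i\<close>.  Mild ineffability gives, by a Solovay type argument,
  families of \<open>|U i|\<^sup>+\<close> sets of size less than \<open>k\<close> that are cofinal among all such subsets of
  \<open>U i\<close>.  Thus a set of size \<open>k\<close> determines a function in the product of the \<open>|U i|\<^sup>+\<close>, and these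
  functions are bounded, on unboundedly many \<open>i\<close>, by the members of a suitable family of size
  \<open>m\<^sup>+\<close>, which Shelah's club guessing provides.
\<close>

section \<open>Well-orders and regular cardinals\<close>

text \<open>The successor in the bound is forced: if \<open>|A| > k\<close> has cofinality
  \<open>k\<close>, a diagonal argument shows that \<open>|A|\<close> sets never suffice. It does no
  harm below \<open>l\<close>, since \<open>|B| < m\<close> gives
  \<open>|B|\<^sup>+ \<le> m\<close>; at \<open>l\<close> itself it would, and there
  \<open>cf(l) \<noteq> k\<close> avoids it. The Solovay argument wants regular cardinals, while the
  pieces \<open>U i\<close> may be singular; this is why the product is taken over the
  \<open>|U i|\<^sup>+\<close>. No cardinal arithmetic is available to bound all functions of that
  product. What can be used is that a point below a member of \<open>|U i|\<^sup>+\<close> has a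
  code in \<open>U i\<close>. So whenever a function lies above many members of a family, pressing
  down and the covering families of smaller sets force the codes of their values into one set of
  size \<open>k\<close>. It is therefore enough that any \<open>m\<^sup>+\<close> members of the
  family include \<open>k\<^sup>+\<close> ones with pairwise distinct values at all large
  \<open>i\<close>. To get this from club guessing, sets of size \<open>k\<^sup>+\<close> are
  guessed on \<open>k\<^sup>+\<^sup>+\<^sup>+\<close>.\<close>

abbreviation Reg :: "'a rel \<Rightarrow> bool" where
  "Reg r \<equiv> Cinfinite r \<and> regularCard r"

definition lt :: "'a rel \<Rightarrow> 'a \<Rightarrow> 'a \<Rightarrow> bool" where
  "lt r a b \<longleftrightarrow> (a, b) \<in> r \<and> a \<noteq> b"

text \<open>The strict supremum: \<open>X\<close> lies below it and is cofinal below it, whether or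
  not \<open>X\<close> has a maximum, so limits and successors are treated alike. It is meaningful
  for bounded \<open>X\<close>; the empty set yields the least element.\<close>

definition ssup :: "'a rel \<Rightarrow> 'a set \<Rightarrow> 'a" where
  "ssup r X = (SOME m. m \<in> Field r \<and> (\<forall>x\<in>X. lt r x m) \<and>
     (\<forall>b\<in>Field r. (\<forall>x\<in>X. lt r x b) \<longrightarrow> (m, b) \<in> r))"

lemma lt_Field:
  assumes "lt r a b" shows "a \<in> Field r" "b \<in> Field r"
  using assms by (auto simp: lt_def Field_def)

lemma lt_imp_le: "lt r a b \<Longrightarrow> (a, b) \<in> r"
  by (simp add: lt_def)

lemma lt_irrefl [simp]: "\<not> lt r a a"
  by (simp add: lt_def)

lemma underS_lt: "underS r a = {b. lt r b a}"
  by (auto simp: underS_def lt_def)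

context
  fixes r :: "'a rel"
  assumes wo: "Well_order r"
begin

lemma le_refl: "a \<in> Field r \<Longrightarrow> (a, a) \<in> r"
  using wo by (auto simp: order_on_defs refl_on_def)

lemma le_trans: "(a, b) \<in> r \<Longrightarrow> (b, c) \<in> r \<Longrightarrow> (a, c) \<in> r"
  using wo by (auto simp: order_on_defs dest: transD)

lemma le_antisym: "(a, b) \<in> r \<Longrightarrow> (b, a) \<in> r \<Longrightarrow> a = b"
  using wo by (auto simp: order_on_defs dest: antisymD)

lemma le_lt_trans: "(a, b) \<in> r \<Longrightarrow> lt r b c \<Longrightarrow> lt r a c"
  unfolding lt_def using le_trans le_antisym by blast

lemma lt_le_trans: "lt r a b \<Longrightarrow> (b, c) \<in> r \<Longrightarrow> lt r a c"
  unfolding lt_def using le_trans le_antisym by blast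

lemma lt_trans: "lt r a b \<Longrightarrow> lt r b c \<Longrightarrow> lt r a c"
  using le_lt_trans lt_imp_le by fast

lemma lt_asym: "lt r a b \<Longrightarrow> (b, a) \<notin> r"
  unfolding lt_def using le_antisym by blast

lemma not_lt: "a \<in> Field r \<Longrightarrow> b \<in> Field r \<Longrightarrow> \<not> lt r a b \<Longrightarrow> (b, a) \<in> r"
  using wo le_refl unfolding lt_def order_on_defs total_on_def by metis

lemma not_le: "a \<in> Field r \<Longrightarrow> b \<in> Field r \<Longrightarrow> (a, b) \<notin> r \<Longrightarrow> lt r b a"
  using not_lt by blast

lemma wf_lt: "wf {(a, b). lt r a b}"
proof -
  have "{(a, b). lt r a b} = r - Id" by (auto simp: lt_def)
  then show ?thesis using wo by (simp add: well_order_on_def)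
qed

lemma least_ex:
  assumes "X \<subseteq> Field r" "X \<noteq> {}"
  obtains m where "m \<in> X" "\<And>x. x \<in> X \<Longrightarrow> (m, x) \<in> r"
proof -
  obtain m where m: "m \<in> X" "\<And>y. lt r y m \<Longrightarrow> y \<notin> X"
    using wf_lt assms(2) unfolding wf_eq_minimal by auto
  show ?thesis
    by (rule that[OF m(1)]) (use m not_le assms(1) in blast)
qed

lemma max_ex:
  assumes "a \<in> Field r" "b \<in> Field r"
  obtains m where "(a, m) \<in> r" "(b, m) \<in> r"
proof (cases "(a, b) \<in> r")
  case True
  then show ?thesis using that[of b] le_refl[OF assms(2)] by simp
next
  case False
  then have "(b, a) \<in> r" using not_le[OF assms] lt_imp_le[of r b a] by simp
  then show ?thesis using that[of a] le_refl[OF assms(1)] by simp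
qed

lemma ssup:
  assumes "b \<in> Field r" "\<forall>x\<in>X. lt r x b"
  shows "ssup r X \<in> Field r" "\<And>x. x \<in> X \<Longrightarrow> lt r x (ssup r X)" "(ssup r X, b) \<in> r"
proof -
  let ?B = "{b \<in> Field r. \<forall>x\<in>X. lt r x b}"
  obtain m where m: "m \<in> ?B" "\<And>x. x \<in> ?B \<Longrightarrow> (m, x) \<in> r"
    using assms by (elim least_ex[of ?B, rotated 2]) auto
  have "\<exists>m. m \<in> Field r \<and> (\<forall>x\<in>X. lt r x m) \<and> (\<forall>b\<in>Field r. (\<forall>x\<in>X. lt r x b) \<longrightarrow> (m, b) \<in> r)"
    using m by blast
  from someI_ex[OF this, folded ssup_def] assms
  show "ssup r X \<in> Field r" "\<And>x. x \<in> X \<Longrightarrow> lt r x (ssup r X)" "(ssup r X, b) \<in> r"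
    by blast+
qed

lemma lt_ssup:
  assumes "b \<in> Field r" "\<forall>x\<in>X. lt r x b" "lt r a (ssup r X)" "X \<subseteq> Field r"
  shows "\<exists>x\<in>X. (a, x) \<in> r"
proof (rule ccontr)
  assume n: "\<not> (\<exists>x\<in>X. (a, x) \<in> r)"
  have a: "a \<in> Field r" using assms(3) lt_Field by fast
  have "(ssup r X, a) \<in> r"
    by (rule ssup(3)[OF a]) (use n not_le a assms(4) in blast)
  then show False using assms(3) lt_asym by fast
qed

text \<open>Transfinite recursion when the next value is only known to exist. By \<open>adm\<close>
  the requirement at \<open>x\<close> sees nothing but earlier values, so it can be imposed during
  the construction.\<close>

lemma wo_choice:
  assumes adm: "\<And>f g x y. (\<And>z. lt r z x \<Longrightarrow> f z = g z) \<Longrightarrow> P f x y = P g x y"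
    and ex: "\<And>x f. x \<in> Field r \<Longrightarrow> (\<And>y. lt r y x \<Longrightarrow> P f y (f y)) \<Longrightarrow> \<exists>y. P f x y"
  obtains f where "\<And>x. x \<in> Field r \<Longrightarrow> P f x (f x)"
proof -
  have "\<exists>f. \<forall>x. x \<in> Field r \<longrightarrow> P f x (f x)"
  proof (rule dependent_wf_choice[OF wf_lt, where P = "\<lambda>f x y. x \<in> Field r \<longrightarrow> P f x y"])
    fix f g :: "'a \<Rightarrow> 'b" and x y
    assume "\<And>z. (z, x) \<in> {(a, b). lt r a b} \<Longrightarrow> f z = g z"
    then have "P f x y = P g x y" by (intro adm) auto
    then show "(x \<in> Field r \<longrightarrow> P f x y) = (x \<in> Field r \<longrightarrow> P g x y)" by simp
  next
    fix x and f :: "'a \<Rightarrow> 'b"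
    assume *: "\<And>y. (y, x) \<in> {(a, b). lt r a b} \<Longrightarrow> y \<in> Field r \<longrightarrow> P f y (f y)"
    show "\<exists>y. x \<in> Field r \<longrightarrow> P f x y"
      using ex[of x f] * by (cases "x \<in> Field r") (auto dest: lt_Field)
  qed
  then show ?thesis using that by blast
qed

end

section \<open>Boundedness and pigeonhole principles for cardinals\<close>

lemma Card_order_wo: "Card_order r \<Longrightarrow> Well_order r"
  by (rule card_order_on_well_order_on)

lemma not_ordLess: "Card_order r \<Longrightarrow> \<not> |A| <o r \<longleftrightarrow> r \<le>o |A|"
  by (simp add: Card_order_wo card_of_Well_order not_ordLess_iff_ordLeq)

lemma succ_ex:
  assumes "Cinfinite r" "a \<in> Field r"
  obtains b where "lt r a b"
  using infinite_Card_order_limit[of r a] assms by (auto simp: cinfinite_def lt_def)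

lemma not_cofinal_bounded:
  assumes r: "Cinfinite r" and X: "X \<subseteq> Field r" and "\<not> cofinal X r"
  shows "\<exists>b\<in>Field r. \<forall>x\<in>X. lt r x b"
proof -
  note wo = Card_order_wo[OF conjunct2[OF r]]
  obtain a where a: "a \<in> Field r" "\<And>x. x \<in> X \<Longrightarrow> \<not> lt r a x"
    using assms(3) by (auto simp: cofinal_def lt_def)
  obtain b where b: "lt r a b" using succ_ex[OF r a(1)] .
  have "lt r x b" if "x \<in> X" for x
    using a X that b not_lt[OF wo a(1), of x] le_lt_trans[OF wo] by blast
  then show ?thesis using b lt_Field by fast
qed

lemma Reg_bounded:
  assumes r: "Reg r" and X: "X \<subseteq> Field r" and "|X| <o r"
  shows "\<exists>b\<in>Field r. \<forall>x\<in>X. lt r x b"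
  using not_cofinal_bounded[of r X] assms unfolding regularCard_def
  by (blast dest: not_ordLess_ordIso)

lemma Reg_stable: "Reg r \<Longrightarrow> stable r"
  by (simp add: regularCard_stable cinfinite_def)

lemma Reg_cardSuc: "Cinfinite r \<Longrightarrow> Reg (cardSuc r)"
  using Cinfinite_cardSuc[of r] infinite_cardSuc_regularCard[of r] unfolding cinfinite_def by blast

lemma initial_small: "Card_order r \<Longrightarrow> a \<in> Field r \<Longrightarrow> |{b. lt r b a}| <o r"
  using card_of_underS[of r a] by (simp add: underS_lt)

lemma initial_small_le:
  assumes r: "Cinfinite r" and a: "a \<in> Field r"
  shows "|{b. (b, a) \<in> r}| <o r"
proof -
  note wo = Card_order_wo[OF conjunct2[OF r]]
  obtain b where b: "lt r a b" using succ_ex[OF r a] .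
  have "{x. (x, a) \<in> r} \<subseteq> {x. lt r x b}" using le_lt_trans[OF wo _ b] by blast
  then have "|{x. (x, a) \<in> r}| \<le>o |{x. lt r x b}|" by (rule card_of_mono1)
  then show ?thesis using initial_small[of r b] r lt_Field(2)[OF b] ordLeq_ordLess_trans by blast
qed

text \<open>If every fibre were smaller than \<open>r\<close>, stability would make their union
  smaller than \<open>r\<close> as well.\<close>

lemma pigeonhole_stable:
  assumes r: "Card_order r" "stable r" and "|B| <o r" and "f ` A \<subseteq> B" and "r \<le>o |A|"
  shows "\<exists>b\<in>B. r \<le>o |{a \<in> A. f a = b}|"
proof (rule ccontr)
  assume "\<not> ?thesis"
  then have "|{a \<in> A. f a = b}| <o r" if "b \<in> B" for b
    using that not_ordLess[OF r(1)] by blast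
  then have "|\<Union>b\<in>B. {a \<in> A. f a = b}| <o r"
    by (rule stable_UNION[OF r(2) assms(3)])
  moreover have "(\<Union>b\<in>B. {a \<in> A. f a = b}) = A" using assms(4) by auto
  ultimately show False using assms(5) not_ordLess[OF r(1)] by auto
qed

lemma ordLess_Cinfinite_mono:
  assumes "Cinfinite r" "r <o s" "Card_order s" shows "Cinfinite s"
  using assms cinfinite_mono[OF ordLess_imp_ordLeq[OF assms(2)]] by simp

lemma card_of_ordLeq_Field: "Card_order r \<Longrightarrow> A \<subseteq> Field r \<Longrightarrow> |A| \<le>o r"
  using ordLeq_ordIso_trans[OF card_of_mono1 card_of_Field_ordIso] .

lemma UNION_ordLeq:
  assumes "Cinfinite r" "|I| \<le>o r" "\<And>i. i \<in> I \<Longrightarrow> |A i| \<le>o r"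
  shows "|\<Union>i\<in>I. A i| \<le>o r"
proof (rule card_of_UNION_ordLeq_infinite_Field)
  show "infinite (Field r)" "Card_order r" using assms(1) by (simp_all add: cinfinite_def)
qed (use assms(2,3) in auto)

lemma card_of_UNIV_ordLess:
  assumes "natLeq <o r" shows "|range (f :: nat \<Rightarrow> 'a)| <o r"
proof -
  have "|range f| \<le>o |UNIV :: nat set|" by (rule card_of_image)
  also have "|UNIV :: nat set| =o natLeq" by (rule card_of_nat)
  also note assms
  finally show ?thesis .
qed

lemma finite_ordLess: "natLeq <o r \<Longrightarrow> finite A \<Longrightarrow> |A| <o r"
  by (rule ordLess_transitive[of _ natLeq]) (simp_all add: finite_iff_ordLess_natLeq[symmetric])

section \<open>Mild ineffability and small covering families\<close>

text \<open>The questions to be decided concern pairs of a list and a point instead of points of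
  \<open>l\<close>, so \<open>s\<close> is carried over along an injection \<open>c\<close>. Cutting
  \<open>s (pre a)\<close> down to \<open>pre a\<close> meets the requirement on set assignments and
  changes nothing inside \<open>b\<close>, where alone the sets are compared.\<close>

lemma mildly_ineffable_transfer:
  fixes k :: "'b rel" and l :: "'a rel" and J :: "'c set" and s :: "'c set \<Rightarrow> 'c set"
  assumes mild: "mildly_ineffable k l" and l: "Card_order l" and J: "|J| \<le>o l"
  obtains S where
    "\<And>b. b \<subseteq> J \<Longrightarrow> |b| <o k \<Longrightarrow> \<exists>a\<subseteq>J. |a| <o k \<and> b \<subseteq> a \<and> S \<inter> b = s a \<inter> b"
proof -
  have "|J| \<le>o |Field l|"
    by (rule ordLeq_ordIso_trans[OF J ordIso_symmetric[OF card_of_Field_ordIso[OF l]]])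
  then obtain c where c: "inj_on c J" "c ` J \<subseteq> Field l"
    unfolding card_of_ordLeq[symmetric] by blast
  define pre where "pre a = {j \<in> J. c j \<in> a}" for a
  define s' where "s' a = c ` (s (pre a) \<inter> pre a)" for a
  have "\<forall>a \<in> P_less k (Field l). s' a \<subseteq> a"
    by (auto simp: s'_def pre_def)
  from mild[unfolded mildly_ineffable_def, THEN spec, THEN mp, OF this]
  obtain S' where "S' \<subseteq> Field l \<and> (\<forall>b \<in> P_less k (Field l).
      \<exists>a \<in> P_less k (Field l). b \<subseteq> a \<and> S' \<inter> b = s' a \<inter> b)" ..
  note S' = bspec[OF conjunct2[OF this]]
  show ?thesis
  proof (rule that[of "{j \<in> J. c j \<in> S'}"])
    fix b assume b: "b \<subseteq> J" "|b| <o k"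
    have "c ` b \<in> P_less k (Field l)"
      using b c(2) ordLeq_ordLess_trans[OF card_of_image b(2)] by (auto simp: P_less_def)
    from S'[OF this] obtain a where a: "a \<subseteq> Field l" "|a| <o k" "c ` b \<subseteq> a"
      "S' \<inter> c ` b = s' a \<inter> c ` b" by (auto simp: P_less_def)
    have "|pre a| \<le>o |a|"
      by (rule card_of_ordLeqI[of c]) (use c(1) in \<open>auto simp: pre_def inj_on_def\<close>)
    then have "|pre a| <o k" by (rule ordLeq_ordLess_trans[OF _ a(2)])
    moreover have ba: "b \<subseteq> pre a" using a(3) b(1) by (auto simp: pre_def)
    moreover have "{j \<in> J. c j \<in> S'} \<inter> b = s (pre a) \<inter> b"
    proof -
      have "c x \<in> S' \<longleftrightarrow> x \<in> s (pre a)" if x: "x \<in> b" for x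
      proof -
        have "c x \<in> S' \<longleftrightarrow> c x \<in> s' a" using a(4) x by blast
        also have "\<dots> \<longleftrightarrow> x \<in> s (pre a)"
          using c(1) x ba unfolding s'_def inj_on_def by (auto simp: pre_def subset_iff)
        finally show ?thesis .
      qed
      then show ?thesis using b(1) by auto
    qed
    moreover have "pre a \<subseteq> J" by (auto simp: pre_def)
    ultimately show "\<exists>a\<subseteq>J. |a| <o k \<and> b \<subseteq> a \<and> {j \<in> J. c j \<in> S'} \<inter> b = s a \<inter> b"
      by blast
  qed
qed

lemma card_of_lists_ordLeq:
  fixes r :: "'a rel"
  assumes r: "Cinfinite r"
  shows "|lists (Field r)| \<le>o r"
proof -
  have inf: "infinite (Field r)" and co: "Card_order r" using r by (auto simp: cinfinite_def)
  have len: "|{x \<in> lists (Field r). length x = n}| \<le>o r" for n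
  proof (induction n)
    case 0
    obtain a where "a \<in> Field r" using inf by fastforce
    have "|{x \<in> lists (Field r). length x = 0}| \<le>o |Field r|"
      by (rule card_of_ordLeqI[of "\<lambda>_. a"]) (use \<open>a \<in> Field r\<close> in \<open>auto simp: inj_on_def\<close>)
    then show ?case by (rule ordLeq_ordIso_trans[OF _ card_of_Field_ordIso[OF co]])
  next
    case (Suc n)
    have "|{x \<in> lists (Field r). length x = Suc n}| \<le>o |Field r \<times> {x \<in> lists (Field r). length x = n}|"
    proof (rule card_of_ordLeqI[of "\<lambda>x. (hd x, tl x)"])
      show "inj_on (\<lambda>x. (hd x, tl x)) {x \<in> lists (Field r). length x = Suc n}"
      proof (rule inj_onI)
        fix x y assume "x \<in> {x \<in> lists (Field r). length x = Suc n}"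
          "y \<in> {x \<in> lists (Field r). length x = Suc n}" "(hd x, tl x) = (hd y, tl y)"
        then show "x = y" by (cases x; cases y) auto
      qed
    next
      fix x assume "x \<in> {x \<in> lists (Field r). length x = Suc n}"
      then show "(hd x, tl x) \<in> Field r \<times> {x \<in> lists (Field r). length x = n}"
        by (cases x) auto
    qed
    moreover have "|Field r \<times> {x \<in> lists (Field r). length x = n}| \<le>o r"
      by (rule card_of_Times_ordLeq_infinite_Field[OF inf _ Suc.IH co])
        (rule card_of_ordLeq_Field[OF co subset_refl])
    ultimately show ?case by (rule ordLeq_transitive)
  qed
  have "|UNIV :: nat set| \<le>o r"
    by (rule ordIso_ordLeq_trans[OF card_of_nat natLeq_ordLeq_cinfinite[OF r]])
  then have "|\<Union>n. {x \<in> lists (Field r). length x = n}| \<le>o r"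
    by (rule UNION_ordLeq[OF r _ len])
  moreover have "(\<Union>n. {x \<in> lists (Field r). length x = n}) = lists (Field r)" by auto
  ultimately show ?thesis by simp
qed

text \<open>Each entry \<open>b\<close> is a step down: from the current point to a member of its
  chosen cofinal set at or above \<open>b\<close>, then to the strict supremum of the part of
  \<open>Y\<close> below that member. The head of the list acts last. Lists name such points without
  mentioning \<open>Y\<close>, and there are only \<open>r\<close> many lists.\<close>

fun desc :: "'c rel \<Rightarrow> ('c \<Rightarrow> 'c set) \<Rightarrow> 'c set \<Rightarrow> 'c list \<Rightarrow> 'c" where
  "desc r A Y [] = ssup r Y"
| "desc r A Y (b # \<sigma>) =
     ssup r {y \<in> Y. lt r y (SOME m. m \<in> A (desc r A Y \<sigma>) \<and> (b, m) \<in> r)}"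

text \<open>
  If \<open>k\<close> were strongly compact, with ultrapower embedding \<open>j\<close>, one would take a small cofinal
  subset of \<open>sup j``r\<close> and let \<open>M\<close> be its trace on \<open>r\<close> (Solovay).  As only few sets are decided
  here, an ordinal playing the role of \<open>sup j``r\<close> is found among the values of \<open>desc\<close>:
  if none of them is the right one, they descend infinitely often.
\<close>

lemma mildly_ineffable_covering:
  fixes k :: "'b rel" and l :: "'a rel" and r :: "'c rel"
  assumes mild: "mildly_ineffable k l" and l: "Card_order l"
    and k: "Reg k" "natLeq <o k" and r: "Reg r" "k <o r" "r \<le>o l"
  obtains M :: "'c \<Rightarrow> 'c set" where "\<And>\<alpha>. |M \<alpha>| <o k"
    "\<And>x. x \<subseteq> Field r \<Longrightarrow> |x| <o k \<Longrightarrow> \<exists>\<alpha>\<in>Field r. x \<subseteq> M \<alpha>"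
proof -
  let ?F = "Field r"
  have cinf: "Cinfinite r" and co: "Card_order r" and inf: "infinite (Field r)"
    using r(1) by (auto simp: cinfinite_def)
  note wo = Card_order_wo[OF co]
  note st = Reg_stable[OF k(1)]
  \<comment> \<open>A point \<open>ssup r Y\<close> with small \<open>Y\<close> has the small
    cofinal set \<open>Y\<close>, but this varies with \<open>Y\<close>. The set
    \<open>A \<alpha>\<close> is chosen from \<open>\<alpha>\<close> alone, so that the traces
    \<open>M \<alpha>\<close> are indexed by \<open>r\<close>; it is empty where no small cofinal
    set exists.\<close>
  define isA where "isA \<alpha> A \<longleftrightarrow> A \<subseteq> {x. lt r x \<alpha>} \<and> |A| <o k \<and> (\<forall>b. lt r b \<alpha> \<longrightarrow> (\<exists>m\<in>A. (b, m) \<in> r))" for \<alpha> A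
  define A where "A \<alpha> = (if Ex (isA \<alpha>) then SOME A. isA \<alpha> A else {})" for \<alpha>
  have Asmall: "|A \<alpha>| <o k" for \<alpha>
  proof (cases "Ex (isA \<alpha>)")
    case True
    then have "isA \<alpha> (A \<alpha>)" unfolding A_def using someI_ex[OF True] by simp
    then show ?thesis by (simp add: isA_def)
  next
    case False
    then have "A \<alpha> = {}" unfolding A_def by (rule if_not_P)
    then show ?thesis using finite_ordLess[OF k(2), of "A \<alpha>"] by simp
  qed
  have Aok: "isA \<alpha> (A \<alpha>)" if "isA \<alpha> B" for \<alpha> B
    using that someI_ex[of "isA \<alpha>"] unfolding A_def by auto
  have ubd: "\<exists>b\<in>?F. \<forall>y\<in>Y. lt r y b" if "Y \<subseteq> ?F" "|Y| <o k" for Y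
    using Reg_bounded[OF r(1) that(1) ordLess_transitive[OF that(2) r(2)]] .
  have Assup: "isA (ssup r Y) (A (ssup r Y))" if Y: "Y \<subseteq> ?F" "|Y| <o k" for Y
  proof -
    obtain b where b: "b \<in> ?F" "\<forall>y\<in>Y. lt r y b" using ubd[OF Y] by blast
    have "isA (ssup r Y) Y"
      unfolding isA_def using ssup(2)[OF wo b] lt_ssup[OF wo b _ Y(1)] Y(2) by blast
    then show ?thesis by (rule Aok)
  qed
  let ?D = "desc r A"
  define good where "good Y \<longleftrightarrow> Y \<subseteq> ?F \<and> |Y| <o k" for Y
  have sub: "good {y \<in> Y. P y}" if "good Y" for Y P
    using that ordLeq_ordLess_trans[OF card_of_mono1[of "{y \<in> Y. P y}" Y]] by (auto simp: good_def)
  have Dss: "\<exists>Z. good Z \<and> ?D Y \<sigma> = ssup r Z" if Y: "good Y" for Y \<sigma>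
  proof (cases \<sigma>)
    case (Cons b \<tau>)
    show ?thesis unfolding Cons desc.simps by (rule exI, rule conjI[OF sub[OF Y] refl])
  qed (use Y in auto)
  have DF: "?D Y \<sigma> \<in> ?F" if Y: "good Y" for Y \<sigma>
  proof -
    obtain Z where Z: "Z \<subseteq> ?F" "|Z| <o k" "?D Y \<sigma> = ssup r Z" using Dss[OF Y, of \<sigma>] by (auto simp: good_def)
    obtain b where b: "b \<in> ?F" "\<forall>y\<in>Z. lt r y b" using ubd[OF Z(1,2)] by blast
    show ?thesis using ssup(1)[OF wo b] Z(3) by simp
  qed
  define pick where "pick Y b \<sigma> = (SOME m. m \<in> A (?D Y \<sigma>) \<and> (b, m) \<in> r)" for Y b \<sigma>
  have pick: "pick Y b \<sigma> \<in> A (?D Y \<sigma>)" "(b, pick Y b \<sigma>) \<in> r" "lt r (pick Y b \<sigma>) (?D Y \<sigma>)"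
    if Y: "good Y" and b: "lt r b (?D Y \<sigma>)" for Y b \<sigma>
  proof -
    obtain Z where Z: "Z \<subseteq> ?F" "|Z| <o k" "?D Y \<sigma> = ssup r Z" using Dss[OF Y, of \<sigma>] by (auto simp: good_def)
    have i: "isA (?D Y \<sigma>) (A (?D Y \<sigma>))" using Assup[OF Z(1,2)] Z(3) by simp
    then have "\<exists>m. m \<in> A (?D Y \<sigma>) \<and> (b, m) \<in> r" using b unfolding isA_def by blast
    from someI_ex[OF this, folded pick_def] i
    show "pick Y b \<sigma> \<in> A (?D Y \<sigma>)" "(b, pick Y b \<sigma>) \<in> r" "lt r (pick Y b \<sigma>) (?D Y \<sigma>)"
      unfolding isA_def by blast+
  qed
  have D_Cons: "?D Y (b # \<sigma>) = ssup r {y \<in> Y. lt r y (pick Y b \<sigma>)}" for Y b \<sigma>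
    by (simp add: pick_def)
  have D_le: "(?D Y (b # \<sigma>), pick Y b \<sigma>) \<in> r" if Y: "good Y" and b: "lt r b (?D Y \<sigma>)" for Y b \<sigma>
    unfolding D_Cons by (rule ssup(3)[OF wo]) (use lt_Field(1)[OF pick(3)[OF Y b]] in auto)
  have D_gt: "lt r y (?D Y (b # \<sigma>))" if Y: "good Y" and y: "y \<in> Y" "lt r y (pick Y b \<sigma>)" for Y b \<sigma> y
    unfolding D_Cons by (rule ssup(2)[OF wo lt_Field(2)[OF y(2)]]) (use y in auto)
  have D_Nil: "lt r y (?D Y [])" if Y: "good Y" "y \<in> Y" for Y y
  proof -
    obtain b where b: "b \<in> ?F" "\<forall>y\<in>Y. lt r y b" using ubd[of Y] Y(1) unfolding good_def by blast
    show ?thesis using ssup(2)[OF wo b Y(2)] by simp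
  qed

  let ?J = "lists ?F \<times> ?F"
  have Jl: "|?J| \<le>o l"
    by (rule ordLeq_transitive[OF card_of_Times_ordLeq_infinite_Field[OF inf
          card_of_lists_ordLeq[OF cinf] card_of_ordLeq_Field[OF co subset_refl] co] r(3)])
  \<comment> \<open>The second components of \<open>a\<close> stand for the image of
    \<open>r\<close> under the embedding. What gets decided is, for every list and every
    \<open>\<zeta>\<close>, whether the point reached is at most \<open>\<zeta>\<close>; any fewer
    than \<open>k\<close> of these decisions are realised by one \<open>Y\<close>.\<close>
  define s :: "('c list \<times> 'c) set \<Rightarrow> ('c list \<times> 'c) set" where "s a = {(\<sigma>, \<zeta>). (?D (snd ` a) \<sigma>, \<zeta>) \<in> r}" for a
  obtain S where S: "\<And>b. b \<subseteq> ?J \<Longrightarrow> |b| <o k \<Longrightarrow> \<exists>a\<subseteq>?J. |a| <o k \<and> b \<subseteq> a \<and> S \<inter> b = s a \<inter> b"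
    by (rule mildly_ineffable_transfer[OF mild l Jl, where s = s]) (rule that)
  have S': "\<exists>Y. good Y \<and> snd ` b \<subseteq> Y \<and> (\<forall>(\<sigma>, \<zeta>)\<in>b. (\<sigma>, \<zeta>) \<in> S \<longleftrightarrow> (?D Y \<sigma>, \<zeta>) \<in> r)"
    if b: "b \<subseteq> ?J" "|b| <o k" for b
  proof -
    obtain a where a: "a \<subseteq> ?J" "|a| <o k" "b \<subseteq> a" "S \<inter> b = s a \<inter> b" using S[OF b] by blast
    have "good (snd ` a)" using a(1) ordLeq_ordLess_trans[OF card_of_image a(2)] by (auto simp: good_def)
    moreover have "\<forall>(\<sigma>, \<zeta>)\<in>b. (\<sigma>, \<zeta>) \<in> S \<longleftrightarrow> (?D (snd ` a) \<sigma>, \<zeta>) \<in> r"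
      using a(4) by (auto simp: s_def)
    ultimately show ?thesis using a(3) by blast
  qed
  \<comment> \<open>The point of a big list is decided to lie above all of \<open>r\<close>.\<close>
  define big where "big \<sigma> \<longleftrightarrow> \<sigma> \<in> lists ?F \<and> (\<forall>\<zeta>\<in>?F. (\<sigma>, \<zeta>) \<notin> S)" for \<sigma>
  have "big []"
    unfolding big_def
  proof (intro conjI ballI)
    fix \<zeta> assume z: "\<zeta> \<in> ?F"
    have "{([], \<zeta>)} \<subseteq> ?J" using z by simp
    from S'[OF this finite_ordLess[OF k(2)]] obtain Y where Y: "good Y" "\<zeta> \<in> Y"
      "([], \<zeta>) \<in> S \<longleftrightarrow> (?D Y [], \<zeta>) \<in> r" by auto
    have "lt r \<zeta> (?D Y [])" by (rule D_Nil[OF Y(1,2)])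
    then show "([], \<zeta>) \<notin> S" using Y(3) lt_asym[OF wo] by blast
  qed simp
  \<comment> \<open>Otherwise big lists could be extended for ever. Since \<open>k\<close> is
    uncountable, a single \<open>Y\<close> realises the countably many decisions involved, and its
    points would descend infinitely often.\<close>
  have "\<exists>\<sigma>. big \<sigma> \<and> (\<forall>b\<in>?F. \<not> big (b # \<sigma>))"
  proof (rule ccontr)
    assume "\<not> ?thesis"
    then obtain g where g: "\<And>\<sigma>. big \<sigma> \<Longrightarrow> g \<sigma> \<in> ?F \<and> big (g \<sigma> # \<sigma>)" by metis
    define \<tau> where "\<tau> n = ((\<lambda>\<sigma>. g \<sigma> # \<sigma>) ^^ n) []" for n
    have t0: "\<tau> 0 = []" and tS: "\<tau> (Suc n) = g (\<tau> n) # \<tau> n" for n by (simp_all add: \<tau>_def)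
    have bt: "big (\<tau> n)" for n
    proof (induction n)
      case 0 then show ?case using \<open>big []\<close> by (simp add: t0)
    next
      case (Suc n) then show ?case using g by (simp add: tS)
    qed
    let ?b = "range (\<lambda>n. (\<tau> n, g (\<tau> n)))"
    have "?b \<subseteq> ?J" using bt g by (auto simp: big_def)
    from S'[OF this card_of_UNIV_ordLess[OF k(2)]] obtain Y where Y: "good Y"
      "\<And>n. (\<tau> n, g (\<tau> n)) \<in> S \<longleftrightarrow> (?D Y (\<tau> n), g (\<tau> n)) \<in> r" by auto
    have gt: "lt r (g (\<tau> n)) (?D Y (\<tau> n))" for n
      using Y bt[of n] g[OF bt[of n]] not_le[OF wo DF[OF Y(1), of "\<tau> n"]] unfolding big_def by blast
    have "lt r (?D Y (\<tau> (Suc n))) (?D Y (\<tau> n))" for n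
      unfolding tS
      by (rule le_lt_trans[OF wo D_le[OF Y(1) gt] pick(3)[OF Y(1) gt]])
    then show False using wf_lt[OF wo] unfolding wf_iff_no_infinite_down_chain
      by (auto dest!: spec[of _ "\<lambda>n. ?D Y (\<tau> n)"])
  qed
  then obtain \<sigma> where s: "big \<sigma>" "\<And>b. b \<in> ?F \<Longrightarrow> \<not> big (b # \<sigma>)" by blast
  have sl: "\<sigma> \<in> lists ?F" using s(1) by (simp add: big_def)
  have "\<exists>z\<in>?F. (b # \<sigma>, z) \<in> S" if "b \<in> ?F" for b
    using s(2)[OF that] that sl by (auto simp: big_def)
  then obtain \<zeta> where z: "\<And>b. b \<in> ?F \<Longrightarrow> \<zeta> b \<in> ?F \<and> (b # \<sigma>, \<zeta> b) \<in> S" by metis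
  \<comment> \<open>That the step \<open>b\<close> from \<open>\<sigma>\<close> ends at or below
    \<open>\<zeta> b\<close> means that the cofinal set meets the interval from \<open>b\<close> to
    \<open>\<zeta> b\<close>. With \<open>\<eta>\<close> sparse enough, the intervals starting at
    the points \<open>\<eta> x\<close> are pairwise disjoint, so a trace defined by meeting them is
    no larger than \<open>A \<alpha>\<close>.\<close>
  obtain \<eta> where eta: "\<And>x. x \<in> ?F \<Longrightarrow> \<eta> x \<in> ?F \<and> (\<forall>y. lt r y x \<longrightarrow> lt r (\<zeta> (\<eta> y)) (\<eta> x))"
  proof (rule wo_choice[OF wo, where P = "\<lambda>f x y. y \<in> ?F \<and> (\<forall>z. lt r z x \<longrightarrow> lt r (\<zeta> (f z)) y)"])
    fix x and f :: "'c \<Rightarrow> 'c"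
    assume x: "x \<in> ?F" and IH: "\<And>y. lt r y x \<Longrightarrow> f y \<in> ?F \<and> (\<forall>z. lt r z y \<longrightarrow> lt r (\<zeta> (f z)) (f y))"
    let ?X = "(\<lambda>y. \<zeta> (f y)) ` {y. lt r y x}"
    have "|?X| <o r" by (rule ordLeq_ordLess_trans[OF card_of_image initial_small[OF co x]])
    moreover have "?X \<subseteq> ?F" using IH z by auto
    ultimately show "\<exists>y. y \<in> ?F \<and> (\<forall>z. lt r z x \<longrightarrow> lt r (\<zeta> (f z)) y)"
      using Reg_bounded[OF r(1), of ?X] by auto
  qed (auto simp del: not_all)
  define M where "M \<alpha> = {x \<in> ?F. \<exists>m\<in>A \<alpha>. (\<eta> x, m) \<in> r \<and> (m, \<zeta> (\<eta> x)) \<in> r}" for \<alpha>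
  show ?thesis
  proof (rule that[of M])
    fix \<alpha>
    define h where "h x = (SOME m. m \<in> A \<alpha> \<and> (\<eta> x, m) \<in> r \<and> (m, \<zeta> (\<eta> x)) \<in> r)" for x
    have h: "h x \<in> A \<alpha> \<and> (\<eta> x, h x) \<in> r \<and> (h x, \<zeta> (\<eta> x)) \<in> r" if "x \<in> M \<alpha>" for x
      unfolding h_def by (rule someI_ex) (use that in \<open>auto simp: M_def\<close>)
    have hlt: "lt r (h x) (h y)" if "x \<in> M \<alpha>" "y \<in> M \<alpha>" "lt r x y" for x y
    proof -
      have "lt r (\<zeta> (\<eta> x)) (\<eta> y)" using eta[of y] that by (auto simp: M_def)
      then show ?thesis using h[OF that(1)] h[OF that(2)] le_lt_trans[OF wo] lt_le_trans[OF wo] by blast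
    qed
    have "inj_on h (M \<alpha>)"
    proof (rule inj_onI, rule ccontr)
      fix x y assume *: "x \<in> M \<alpha>" "y \<in> M \<alpha>" "h x = h y" "x \<noteq> y"
      then have "lt r x y \<or> lt r y x" using not_lt[OF wo, of x y] by (auto simp: M_def lt_def)
      then show False using hlt[of x y] hlt[of y x] * by auto
    qed
    then have "|M \<alpha>| \<le>o |A \<alpha>|" by (rule card_of_ordLeqI) (use h in auto)
    then show "|M \<alpha>| <o k" by (rule ordLeq_ordLess_trans[OF _ Asmall])
  next
    fix x assume x: "x \<subseteq> ?F" "|x| <o k"
    \<comment> \<open>The first pairs state that the step \<open>b\<close> ends at or below
      \<open>\<zeta> b\<close>, and they also put \<open>\<zeta> b\<close> into \<open>Y\<close>;
      the second pairs state that \<open>b\<close> is below the point of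
      \<open>\<sigma>\<close>.\<close>
    let ?b = "(\<lambda>b. (b # \<sigma>, \<zeta> b)) ` \<eta> ` x \<union> (\<lambda>b. (\<sigma>, b)) ` \<eta> ` x"
    have ex: "b \<in> \<eta> ` x \<Longrightarrow> b \<in> ?F" for b using x(1) eta by auto
    have "|?b| <o k"
    proof -
      have kinf: "infinite (Field k)" and kco: "Card_order k" using k(1) by (auto simp: cinfinite_def)
      have "|\<eta> ` x| <o k" by (rule ordLeq_ordLess_trans[OF card_of_image x(2)])
      then have "|(\<lambda>b. (b # \<sigma>, \<zeta> b)) ` \<eta> ` x| <o k" "|(\<lambda>b. (\<sigma>, b)) ` \<eta> ` x| <o k"
        by (rule ordLeq_ordLess_trans[OF card_of_image])+
      then show ?thesis by (rule card_of_Un_ordLess_infinite_Field[OF kinf kco])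
    qed
    moreover have "?b \<subseteq> ?J" using ex z sl by auto
    ultimately obtain Y where Y: "good Y" "snd ` ?b \<subseteq> Y"
      and "\<forall>(\<sigma>', \<zeta>')\<in>?b. (\<sigma>', \<zeta>') \<in> S \<longleftrightarrow> (?D Y \<sigma>', \<zeta>') \<in> r" using S'[of ?b] by auto
    then have Y1: "(b # \<sigma>, \<zeta> b) \<in> S \<longleftrightarrow> (?D Y (b # \<sigma>), \<zeta> b) \<in> r"
      and Y2: "(\<sigma>, b) \<in> S \<longleftrightarrow> (?D Y \<sigma>, b) \<in> r" if "b \<in> \<eta> ` x" for b
      using that by (auto simp del: desc.simps)
    have zY: "\<zeta> b \<in> Y" if "b \<in> \<eta> ` x" for b using that Y(2) by force
    have "x \<subseteq> M (?D Y \<sigma>)"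
    proof
      fix \<xi> assume xi: "\<xi> \<in> x"
      let ?e = "\<eta> \<xi>"
      have eF: "?e \<in> ?F" and ei: "?e \<in> \<eta> ` x" using xi ex by auto
      have "(?D Y \<sigma>, ?e) \<notin> r" using Y2[OF ei] s(1) eF unfolding big_def by blast
      then have lt: "lt r ?e (?D Y \<sigma>)" by (rule not_le[OF wo DF[OF Y(1)] eF])
      note p = pick[OF Y(1) lt]
      have "(pick Y ?e \<sigma>, \<zeta> ?e) \<in> r"
      proof (rule not_lt[OF wo])
        show "\<zeta> ?e \<in> ?F" using z[OF eF] by simp
        show "pick Y ?e \<sigma> \<in> ?F" using lt_Field(1)[OF p(3)] .
        \<comment> \<open>Being in \<open>Y\<close>, a \<open>\<zeta> ?e\<close> below the picked
          member would be among the points whose strict supremum is the next point, so the step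
          could not end at or below it.\<close>
        show "\<not> lt r (\<zeta> ?e) (pick Y ?e \<sigma>)"
        proof
          assume "lt r (\<zeta> ?e) (pick Y ?e \<sigma>)"
          from D_gt[OF Y(1) zY[OF ei] this] show False
            using Y1[OF ei] z[OF eF] lt_asym[OF wo] by blast
        qed
      qed
      then show "\<xi> \<in> M (?D Y \<sigma>)" using p x(1) xi by (auto simp: M_def)
    qed
    then show "\<exists>\<alpha>\<in>?F. x \<subseteq> M \<alpha>" using DF[OF Y(1)] by blast
  qed
qed

section \<open>Club guessing\<close>

text \<open>The last conjunct says that \<open>G\<close> is closed and contains the least element.\<close>

definition club :: "'d rel \<Rightarrow> 'd set \<Rightarrow> bool" where
  "club t G \<longleftrightarrow> G \<subseteq> Field t \<and> (\<forall>a\<in>Field t. \<exists>g\<in>G. lt t a g) \<and>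
     (\<forall>c\<in>Field t. \<exists>g\<in>G. (g, c) \<in> t \<and> (\<forall>g'\<in>G. (g', c) \<in> t \<longrightarrow> (g', g) \<in> t))"

text \<open>The supremum of \<open>G \<inter> (c + 1)\<close>, attained because \<open>G\<close> is
  closed; it moves an arbitrary cofinal set into the club.\<close>

definition prj :: "'d rel \<Rightarrow> 'd set \<Rightarrow> 'd \<Rightarrow> 'd" where
  "prj t G c = (SOME g. g \<in> G \<and> (g, c) \<in> t \<and> (\<forall>g'\<in>G. (g', c) \<in> t \<longrightarrow> (g', g) \<in> t))"

lemma club_prj:
  assumes "club t G" "c \<in> Field t"
  shows "prj t G c \<in> G" "(prj t G c, c) \<in> t" "\<And>g. g \<in> G \<Longrightarrow> (g, c) \<in> t \<Longrightarrow> (g, prj t G c) \<in> t"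
proof -
  have "\<exists>g. g \<in> G \<and> (g, c) \<in> t \<and> (\<forall>g'\<in>G. (g', c) \<in> t \<longrightarrow> (g', g) \<in> t)"
    using assms unfolding club_def by fast
  from someI_ex[OF this, folded prj_def]
  show "prj t G c \<in> G" "(prj t G c, c) \<in> t" "\<And>g. g \<in> G \<Longrightarrow> (g, c) \<in> t \<Longrightarrow> (g, prj t G c) \<in> t"
    by simp_all
qed

lemma club_subset: "club t G \<Longrightarrow> G \<subseteq> Field t"
  by (simp add: club_def)

lemma club_unbounded: "club t G \<Longrightarrow> a \<in> Field t \<Longrightarrow> \<exists>g\<in>G. lt t a g"
  by (simp add: club_def)

text \<open>Closing off: the step is iterated \<omega> times, and the supremum exists because
  \<open>t\<close> is regular and uncountable.\<close>

lemma omega_limit: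
  fixes t :: "'d rel"
  assumes t: "Reg t" "natLeq <o t" and a: "a \<in> Field t"
    and step: "\<And>x. x \<in> Field t \<Longrightarrow> \<exists>y. lt t x y \<and> Q x y"
  obtains b s where "b 0 = a" "\<And>n. b n \<in> Field t" "\<And>n. lt t (b n) (b (Suc n))"
    "\<And>n. Q (b n) (b (Suc n))" "s \<in> Field t" "\<And>n. lt t (b n) s"
    "\<And>x. lt t x s \<Longrightarrow> \<exists>n. (x, b n) \<in> t"
proof -
  have wo: "Well_order t" using t(1) Card_order_wo by blast
  obtain nx where nx: "\<And>x. x \<in> Field t \<Longrightarrow> lt t x (nx x) \<and> Q x (nx x)" using step by metis
  define b where "b n = (nx ^^ n) a" for n
  have b0: "b 0 = a" and bS: "b (Suc n) = nx (b n)" for n by (simp_all add: b_def)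
  have bF: "b n \<in> Field t" for n
  proof (induction n)
    case 0 then show ?case using a by (simp add: b0)
  next
    case (Suc n) then show ?case using nx[OF Suc] lt_Field(2) unfolding bS by fast
  qed
  then have bF': "range b \<subseteq> Field t" by blast
  obtain u where u: "u \<in> Field t" "\<forall>x\<in>range b. lt t x u"
    using Reg_bounded[OF t(1) bF' card_of_UNIV_ordLess[OF t(2)]] by blast
  note s = ssup[OF wo u]
  show ?thesis
  proof (rule that[of b "ssup t (range b)"])
    show "b 0 = a" by (rule b0)
    show "b n \<in> Field t" for n by (rule bF)
    show "lt t (b n) (b (Suc n))" "Q (b n) (b (Suc n))" for n using nx[OF bF[of n]] unfolding bS by simp_all
    show "ssup t (range b) \<in> Field t" by (rule s(1))
    show "lt t (b n) (ssup t (range b))" for n by (rule s(2)[OF rangeI])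
    show "\<exists>n. (x, b n) \<in> t" if "lt t x (ssup t (range b))" for x
      using lt_ssup[OF wo u that bF'] by blast
  qed
qed

text \<open>If every \<open>G i\<close> has a member between any two consecutive terms of an
  \<omega>-sequence, the limit of the sequence equals its projection to each \<open>G i\<close> and
  so lies in all of them. Regularity allows the members chosen at one stage to be bounded.\<close>

lemma club_Inter:
  fixes t :: "'d rel" and I :: "'i set"
  assumes t: "Reg t" "natLeq <o t" and I: "|I| <o t" and G: "\<And>i. i \<in> I \<Longrightarrow> club t (G i)"
  shows "club t {x \<in> Field t. \<forall>i\<in>I. x \<in> G i}"
proof -
  have wo: "Well_order t" using t(1) Card_order_wo by blast
  let ?H = "{x \<in> Field t. \<forall>i\<in>I. x \<in> G i}"
  have unb: "\<exists>g\<in>?H. lt t a g" if a: "a \<in> Field t" for a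
  proof -
    have step: "\<exists>b. lt t \<beta> b \<and> (\<forall>i\<in>I. \<exists>g\<in>G i. lt t \<beta> g \<and> lt t g b)" if b: "\<beta> \<in> Field t" for \<beta>
    proof -
      have "\<forall>i\<in>I. \<exists>g. g \<in> G i \<and> lt t \<beta> g" using club_unbounded[OF G b] by blast
      then obtain g where g: "\<And>i. i \<in> I \<Longrightarrow> g i \<in> G i \<and> lt t \<beta> (g i)" by metis
      have "g ` I \<subseteq> Field t" using g lt_Field(2) by fast
      then obtain b where b1: "b \<in> Field t" "\<forall>x\<in>g ` I. lt t x b"
        using Reg_bounded[OF t(1) _ ordLeq_ordLess_trans[OF card_of_image I]] by meson
      obtain b' where b': "lt t \<beta> b'" using succ_ex[of t \<beta>] t(1) b by blast
      obtain m where m: "(b, m) \<in> t" "(b', m) \<in> t"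
        using max_ex[OF wo b1(1) lt_Field(2)[OF b']] .
      have "\<forall>i\<in>I. \<exists>g\<in>G i. lt t \<beta> g \<and> lt t g m"
        using g b1(2) lt_le_trans[OF wo _ m(1)] by blast
      then show ?thesis using lt_le_trans[OF wo b' m(2)] by blast
    qed
    obtain b s where b: "b 0 = a" "\<And>n. b n \<in> Field t" "\<And>n. lt t (b n) (b (Suc n))"
      "\<And>n. \<forall>i\<in>I. \<exists>g\<in>G i. lt t (b n) g \<and> lt t g (b (Suc n))"
      and s: "s \<in> Field t" "\<And>n. lt t (b n) s" "\<And>x. lt t x s \<Longrightarrow> \<exists>n. (x, b n) \<in> t"
      by (rule omega_limit[OF t a step]) (assumption, rule that)
    have "s \<in> G i" if i: "i \<in> I" for i
    proof -
      note p = club_prj[OF G[OF i] s(1)]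
      have pF: "prj t (G i) s \<in> Field t" by (rule subsetD[OF club_subset[OF G[OF i]] p(1)])
      have "lt t (b n) (prj t (G i) s)" for n
      proof -
        obtain g where g: "g \<in> G i" "lt t (b n) g" "lt t g (b (Suc n))" using b(4)[of n] i by blast
        have "lt t g s" using lt_trans[OF wo g(3) s(2)] .
        then show ?thesis using p(3)[OF g(1) lt_imp_le] lt_le_trans[OF wo g(2)] by blast
      qed
      then have "\<not> lt t (prj t (G i) s) s" using s(3) lt_asym[OF wo] by blast
      then have "prj t (G i) s = s" using p(2) by (simp add: lt_def)
      then show ?thesis using p(1) by simp
    qed
    moreover have "lt t a s" using s(2)[of 0] b(1) by simp
    ultimately show ?thesis using s(1) by blast
  qed
  have cl: "\<exists>g\<in>?H. (g, c) \<in> t \<and> (\<forall>g'\<in>?H. (g', c) \<in> t \<longrightarrow> (g', g) \<in> t)" if c: "c \<in> Field t" for c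
  proof -
    \<comment> \<open>The least bound of the part of the intersection up to \<open>c\<close> is
      fixed by every projection, since its projection to \<open>G i\<close> is again such a
      bound.\<close>
    let ?U = "{m \<in> Field t. \<forall>x\<in>?H. (x, c) \<in> t \<longrightarrow> (x, m) \<in> t}"
    have cU: "c \<in> ?U" using c by auto
    obtain m where m: "m \<in> ?U" "\<And>x. x \<in> ?U \<Longrightarrow> (m, x) \<in> t"
      by (rule least_ex[OF wo, of ?U]) (use cU in auto)
    have mF: "m \<in> Field t" using m(1) by simp
    have "m \<in> G i" if i: "i \<in> I" for i
    proof -
      note p = club_prj[OF G[OF i] mF]
      have "prj t (G i) m \<in> Field t" by (rule subsetD[OF club_subset[OF G[OF i]] p(1)])
      moreover have "(x, prj t (G i) m) \<in> t" if "x \<in> ?H" "(x, c) \<in> t" for x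
        using p(3)[of x] that m(1) i by auto
      ultimately have "(m, prj t (G i) m) \<in> t" by (intro m(2)) auto
      then show ?thesis using p(1,2) le_antisym[OF wo] by metis
    qed
    then have "m \<in> ?H" using mF by blast
    then show ?thesis using m(1) m(2)[OF cU] by blast
  qed
  show ?thesis unfolding club_def using unb cl by auto
qed

text \<open>\<open>s\<close> is a limit point whose cofinality is the cardinal \<open>h\<close>.\<close>

definition cof_pt :: "'d rel \<Rightarrow> 'e rel \<Rightarrow> 'd \<Rightarrow> bool" where
  "cof_pt t h s \<longleftrightarrow> s \<in> Field t \<and>
     (\<exists>C. C \<subseteq> {b. lt t b s} \<and> |C| \<le>o h \<and> (\<forall>b. lt t b s \<longrightarrow> (\<exists>c\<in>C. (b, c) \<in> t))) \<and>
     (\<forall>D. D \<subseteq> {b. lt t b s} \<longrightarrow> (\<forall>b. lt t b s \<longrightarrow> (\<exists>d\<in>D. (b, d) \<in> t)) \<longrightarrow> h \<le>o |D| )"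

text \<open>A strictly increasing \<open>h\<close>-sequence in \<open>G\<close> has such a supremum:
  as \<open>h\<close> is regular, fewer than \<open>h\<close> points below the supremum all lie
  below one term.\<close>

lemma cof_pt_limit_of_club:
  fixes t :: "'d rel" and h :: "'e rel"
  assumes t: "Reg t" and h: "Reg h" "h <o t"
    and G: "club t G"
  shows "\<exists>s. cof_pt t h s \<and> (\<forall>b. lt t b s \<longrightarrow> (\<exists>g\<in>G. lt t b g \<and> lt t g s))"
proof -
  have wo: "Well_order t" using t Card_order_wo by blast
  have hco: "Card_order h" and hwo: "Well_order h" using h(1) Card_order_wo by blast+
  obtain e where e: "\<And>x. x \<in> Field h \<Longrightarrow> e x \<in> G \<and> (\<forall>y. lt h y x \<longrightarrow> lt t (e y) (e x))"
  proof (rule wo_choice[OF hwo, where P = "\<lambda>f x y. y \<in> G \<and> (\<forall>z. lt h z x \<longrightarrow> lt t (f z) y)"])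
    fix x and f :: "'e \<Rightarrow> 'd"
    assume x: "x \<in> Field h" and IH: "\<And>y. lt h y x \<Longrightarrow> f y \<in> G \<and> (\<forall>z. lt h z y \<longrightarrow> lt t (f z) (f y))"
    let ?X = "f ` {y. lt h y x}"
    have "|?X| <o t"
      by (rule ordLess_transitive[OF ordLeq_ordLess_trans[OF card_of_image initial_small[OF hco x]] h(2)])
    moreover have "?X \<subseteq> Field t" using IH club_subset[OF G] by auto
    ultimately obtain b where b: "b \<in> Field t" "\<forall>x\<in>?X. lt t x b" using Reg_bounded[OF t, of ?X] by auto
    obtain g where "g \<in> G" "lt t b g" using club_unbounded[OF G b(1)] by blast
    then show "\<exists>y. y \<in> G \<and> (\<forall>z. lt h z x \<longrightarrow> lt t (f z) y)"
      using b(2) lt_trans[OF wo] by blast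
  qed auto
  let ?X = "e ` Field h"
  have XF: "?X \<subseteq> Field t" using e club_subset[OF G] by blast
  have Xh: "|?X| \<le>o h"
    by (rule ordLeq_transitive[OF card_of_image card_of_ordLeq_Field[OF hco subset_refl]])
  obtain u where u: "u \<in> Field t" "\<forall>x\<in>?X. lt t x u"
    using Reg_bounded[OF t XF ordLeq_ordLess_trans[OF Xh h(2)]] by blast
  define s where "s = ssup t ?X"
  note s = ssup[OF wo u, folded s_def]
  have cof: "\<exists>x\<in>?X. (b, x) \<in> t" if "lt t b s" for b
    using lt_ssup[OF wo u _ XF, folded s_def] that by simp
  have "cof_pt t h s"
    unfolding cof_pt_def
  proof (intro conjI allI impI exI)
    show "s \<in> Field t" by (rule s(1))
    show "?X \<subseteq> {b. lt t b s}" using s(2) by blast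
    show "|?X| \<le>o h" by (rule Xh)
    show "\<exists>c\<in>?X. (b, c) \<in> t" if "lt t b s" for b by (rule cof[OF that])
    fix D assume D: "D \<subseteq> {b. lt t b s}" "\<forall>b. lt t b s \<longrightarrow> (\<exists>d\<in>D. (b, d) \<in> t)"
    show "h \<le>o |D|"
    proof (rule ccontr)
      assume "\<not> h \<le>o |D|"
      then have Dh: "|D| <o h" using not_ordLess[OF hco] by blast
      have "\<forall>d\<in>D. \<exists>x. x \<in> Field h \<and> (d, e x) \<in> t" using D(1) cof by blast
      then obtain x where x: "\<And>d. d \<in> D \<Longrightarrow> x d \<in> Field h \<and> (d, e (x d)) \<in> t" by metis
      have "x ` D \<subseteq> Field h" using x by blast
      then obtain y where y: "y \<in> Field h" "\<forall>z\<in>x ` D. lt h z y"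
        using Reg_bounded[OF h(1) _ ordLeq_ordLess_trans[OF card_of_image Dh]] by meson
      have "lt t (e y) s" using s(2) y(1) by blast
      then obtain d where d: "d \<in> D" "(e y, d) \<in> t" using D(2) by blast
      have "lt t (e (x d)) (e y)" using e[OF y(1)] y(2) d(1) by blast
      then have "lt t d (e y)" using x[OF d(1)] le_lt_trans[OF wo] by blast
      then show False using d(2) lt_asym[OF wo] by blast
    qed
  qed
  moreover have "\<exists>g\<in>G. lt t b g \<and> lt t g s" if b: "lt t b s" for b
  proof -
    obtain x where x: "x \<in> Field h" "(b, e x) \<in> t" using cof[OF b] by blast
    obtain y where y: "lt h x y" using succ_ex[of h x] h(1) x(1) by blast
    have yF: "y \<in> Field h" using lt_Field(2)[OF y] .
    have "lt t b (e y)" using e[OF yF] y x(2) le_lt_trans[OF wo] by blast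
    then show ?thesis using e[OF yF] s(2)[of "e y"] yF by blast
  qed
  ultimately show ?thesis by blast
qed

text \<open>
  Shelah's argument: start from arbitrary small cofinal sets \<open>W s\<close> and project them to a club.
  If no club is good enough, shrink it \<open>h\<^sup>+\<close> times; every projected point descends along the
  way, so all projections stabilise at some stage.
\<close>

lemma club_guessing:
  fixes t :: "'d rel" and h :: "'e rel"
  assumes t: "Reg t" "natLeq <o t" and h: "Reg h" "cardSuc h <o t"
  obtains \<C> where "|\<C>| \<le>o t"
    "\<And>C. C \<in> \<C> \<Longrightarrow> C \<subseteq> Field t \<and> h \<le>o |C| \<and> (\<forall>x\<in>C. \<exists>y\<in>C. lt t x y)"
    "\<And>G. club t G \<Longrightarrow> \<exists>C\<in>\<C>. C \<subseteq> G"
proof -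
  have tco: "Card_order t" and wo: "Well_order t" using t Card_order_wo by blast+
  have hco: "Card_order h" and hcinf: "Cinfinite h" using h(1) by blast+
  let ?h = "cardSuc h"
  have h': "Reg ?h" using Reg_cardSuc[OF hcinf] .
  have h'co: "Card_order ?h" and h'wo: "Well_order ?h" using h' Card_order_wo by blast+
  have hh': "h <o ?h" using cardSuc_greater[OF hco] .
  have ht: "h <o t" using ordLess_transitive[OF hh' h(2)] .
  define W where "W s = (SOME C. C \<subseteq> {b. lt t b s} \<and> |C| \<le>o h \<and> (\<forall>b. lt t b s \<longrightarrow> (\<exists>c\<in>C. (b, c) \<in> t)))" for s
  have W: "W s \<subseteq> {b. lt t b s} \<and> |W s| \<le>o h \<and> (\<forall>b. lt t b s \<longrightarrow> (\<exists>c\<in>W s. (b, c) \<in> t))"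
    if "cof_pt t h s" for s
    unfolding W_def by (rule someI_ex) (use that in \<open>simp add: cof_pt_def\<close>)
  define lim where "lim G s \<longleftrightarrow> cof_pt t h s \<and> (\<forall>b. lt t b s \<longrightarrow> (\<exists>g\<in>G. lt t b g \<and> lt t g s))" for G s
  define CC where "CC G = (\<lambda>s. prj t G ` W s) ` {s. lim G s}" for G
  have WF: "c \<in> Field t" if "lim G s" "c \<in> W s" for G s c
    using W[of s] that lt_Field(1) unfolding lim_def by fast
  have "\<exists>G. club t G \<and> (\<forall>G'. club t G' \<longrightarrow> (\<exists>C\<in>CC G. C \<subseteq> G'))"
  proof (rule ccontr)
    assume "\<not> ?thesis"
    then obtain N where N: "\<And>G. club t G \<Longrightarrow> club t (N G) \<and> (\<forall>C\<in>CC G. \<not> C \<subseteq> N G)" by metis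
    \<comment> \<open>Each new club lies inside the bad clubs \<open>N\<close> of all earlier ones;
      at the least index there are none and the whole of \<open>t\<close> results. That
      \<open>cardSuc h <o t\<close> keeps these intersections club.\<close>
    define inter where "inter f x = {y \<in> Field t. \<forall>z\<in>{z. lt ?h z x}. y \<in> N (f z)}" for f :: "'e set \<Rightarrow> 'd set" and x
    obtain H where H: "\<And>x. x \<in> Field ?h \<Longrightarrow> club t (H x) \<and> H x = inter H x"
    proof (rule wo_choice[OF h'wo, where P = "\<lambda>f x y. club t y \<and> y = inter f x"])
      fix f g :: "'e set \<Rightarrow> 'd set" and x y
      assume "\<And>z. lt ?h z x \<Longrightarrow> f z = g z"
      then have "inter f x = inter g x" unfolding inter_def by auto
      then show "(club t y \<and> y = inter f x) = (club t y \<and> y = inter g x)" by simp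
    next
      fix x and f :: "'e set \<Rightarrow> 'd set"
      assume x: "x \<in> Field ?h" and IH: "\<And>y. lt ?h y x \<Longrightarrow> club t (f y) \<and> f y = inter f y"
      have "club t (inter f x)"
        unfolding inter_def
      proof (rule club_Inter[OF t])
        show "|{z. lt ?h z x}| <o t" by (rule ordLess_transitive[OF initial_small[OF h'co x] h(2)])
        show "club t (N (f z))" if "z \<in> {z. lt ?h z x}" for z using IH[of z] N[of "f z"] that by blast
      qed
      then show "\<exists>y. club t y \<and> y = inter f x" by blast
    qed blast
    have mono: "H y \<subseteq> H x" if "(x, y) \<in> ?h" "x \<in> Field ?h" "y \<in> Field ?h" for x y
    proof -
      have "inter H y \<subseteq> inter H x" unfolding inter_def using lt_le_trans[OF h'wo _ that(1)] by blast
      then show ?thesis using H[OF that(2)] H[OF that(3)] by simp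
    qed
    let ?G = "{y \<in> Field t. \<forall>x\<in>Field ?h. y \<in> H x}"
    have "club t ?G"
      by (rule club_Inter[OF t ordLeq_ordLess_trans[OF card_of_ordLeq_Field[OF h'co subset_refl] h(2)]])
        (use H in blast)
    from cof_pt_limit_of_club[OF t(1) h(1) ht this] obtain s where s: "lim ?G s"
      unfolding lim_def by blast
    have sW: "cof_pt t h s" using s by (simp add: lim_def)
    have ex: "\<exists>x. x \<in> Field ?h \<and> (\<forall>y\<in>Field ?h. (prj t (H x) c, prj t (H y) c) \<in> t)" if c: "c \<in> W s" for c
    proof -
      note cF = WF[OF s c]
      let ?V = "(\<lambda>x. prj t (H x) c) ` Field ?h"
      have V: "?V \<subseteq> Field t" using H club_prj(1)[OF _ cF] club_subset by blast
      have "?V \<noteq> {}" using Field_cardSuc_not_empty[OF hco] by blast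
      from least_ex[OF wo V this] obtain m where m: "m \<in> ?V" "\<And>x. x \<in> ?V \<Longrightarrow> (m, x) \<in> t" by blast
      from m(1) obtain x where "x \<in> Field ?h" "m = prj t (H x) c" by blast
      then show ?thesis using m(2) by blast
    qed
    then obtain v where v: "\<And>c. c \<in> W s \<Longrightarrow> v c \<in> Field ?h \<and> (\<forall>y\<in>Field ?h. (prj t (H (v c)) c, prj t (H y) c) \<in> t)"
      by metis
    have "v ` W s \<subseteq> Field ?h" using v by blast
    moreover have "|v ` W s| <o ?h"
      by (rule ordLeq_ordLess_trans[OF ordLeq_transitive[OF card_of_image] hh']) (use W[OF sW] in simp)
    ultimately obtain n where n: "n \<in> Field ?h" "\<forall>x\<in>v ` W s. lt ?h x n"
      using Reg_bounded[OF h'] by meson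
    obtain n' where n': "lt ?h n n'" using succ_ex[of ?h n] h' n(1) by blast
    have n'F: "n' \<in> Field ?h" using lt_Field(2)[OF n'] .
    have stable: "prj t (H m) c = prj t (H (v c)) c" if c: "c \<in> W s" and m: "m \<in> Field ?h" "lt ?h (v c) m" for c m
    proof -
      note cF = WF[OF s c]
      have vF: "v c \<in> Field ?h" using v[OF c] by simp
      have cm: "club t (H m)" and cv: "club t (H (v c))" using H m(1) vF by blast+
      have "prj t (H m) c \<in> H (v c)" using mono[OF lt_imp_le[OF m(2)] vF m(1)] club_prj(1)[OF cm cF] by blast
      then have "(prj t (H m) c, prj t (H (v c)) c) \<in> t"
        using club_prj(3)[OF cv cF] club_prj(2)[OF cm cF] by blast
      moreover have "(prj t (H (v c)) c, prj t (H m) c) \<in> t" using v[OF c] m(1) by blast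
      ultimately show ?thesis by (rule le_antisym[OF wo])
    qed
    \<comment> \<open>One stage beyond \<open>n\<close> is needed: the projections are the same at
      \<open>n\<close> and \<open>n'\<close>, hence lie in \<open>H n'\<close>, which is contained
      in the club \<open>N (H n)\<close> that was to defeat stage \<open>n\<close>.\<close>
    have "prj t (H n) ` W s \<subseteq> N (H n)"
    proof
      fix y assume "y \<in> prj t (H n) ` W s"
      then obtain c where c: "c \<in> W s" "y = prj t (H n) c" by blast
      have vn: "lt ?h (v c) n" using n(2) c(1) by blast
      have "y = prj t (H n') c"
        using stable[OF c(1) n(1) vn] stable[OF c(1) n'F lt_trans[OF h'wo vn n']] c(2) by simp
      then have "y \<in> H n'" using club_prj(1)[of t "H n'" c] H[OF n'F] WF[OF s c(1)] by blast
      then show "y \<in> N (H n)" using H[OF n'F] n' unfolding inter_def by blast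
    qed
    moreover have "lim (H n) s" using s n(1) unfolding lim_def by blast
    then have "prj t (H n) ` W s \<in> CC (H n)" unfolding CC_def by blast
    ultimately show False using N[of "H n"] H[OF n(1)] by blast
  qed
  then obtain G where G: "club t G" "\<And>G'. club t G' \<Longrightarrow> \<exists>C\<in>CC G. C \<subseteq> G'" by blast
  show ?thesis
  proof (rule that[of "CC G"])
    have "{s. lim G s} \<subseteq> Field t" unfolding lim_def cof_pt_def by blast
    then show "|CC G| \<le>o t"
      unfolding CC_def by (rule ordLeq_transitive[OF card_of_image card_of_ordLeq_Field[OF tco]])
  next
    fix C assume "C \<in> CC G"
    then obtain s where s: "lim G s" and C: "C = prj t G ` W s" unfolding CC_def by blast
    have sW: "cof_pt t h s" using s by (simp add: lim_def)
    have Cs: "C \<subseteq> {b. lt t b s}"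
      using W[OF sW] WF[OF s] club_prj(2)[OF G(1)] le_lt_trans[OF wo] unfolding C by blast
    have CF: "C \<subseteq> Field t" using WF[OF s] club_prj(1)[OF G(1)] club_subset[OF G(1)] unfolding C by blast
    have cof: "\<exists>c\<in>C. lt t b c" if b: "lt t b s" for b
    proof -
      obtain g where g: "g \<in> G" "lt t b g" "lt t g s" using s b unfolding lim_def by blast
      obtain c where c: "c \<in> W s" "(g, c) \<in> t" using W[OF sW] g(3) by blast
      have "(g, prj t G c) \<in> t" using club_prj(3)[OF G(1) WF[OF s c(1)] g(1) c(2)] .
      then show ?thesis using lt_le_trans[OF wo g(2)] c(1) unfolding C by blast
    qed
    have "h \<le>o |C|"
      using sW Cs cof lt_imp_le unfolding cof_pt_def by meson
    then show "C \<subseteq> Field t \<and> h \<le>o |C| \<and> (\<forall>x\<in>C. \<exists>y\<in>C. lt t x y)"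
      using CF cof Cs by blast
  qed (rule G(2))
qed

section \<open>Free families of functions\<close>

text \<open>
  The sets \<open>a \<alpha> i\<close> exhaust \<open>\<alpha>\<close> in \<open>k\<close> steps.  The function \<open>f \<alpha>\<close> is chosen above \<open>f \<beta>\<close> at \<open>i\<close> for
  \<open>\<beta> \<in> a \<alpha> i\<close>, and everywhere above \<open>f \<beta>\<close> for the \<open>\<beta>\<close> in the closure of a fixed cofinal
  subset of \<open>\<alpha>\<close> of size at most \<open>t\<close>, if there is one.  Club guessing on \<open>t\<close> then yields, inside
  every large set of indices, a large subset on which the functions increase strictly from some
  point on.
\<close>

lemma free_family:
  fixes k :: "'b rel" and t :: "'d rel" and L :: "'c rel" and R :: "'b \<Rightarrow> 'e rel"
    and a :: "'c \<Rightarrow> 'b \<Rightarrow> 'c set"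
  assumes k: "Reg k" and t: "Reg t" "cardSuc (cardSuc k) <o t" and L: "Reg L" "t <o L"
    and R: "\<And>i. i \<in> Field k \<Longrightarrow> Reg (R i) \<and> t <o R i"
    and a: "\<And>\<alpha> i. \<alpha> \<in> Field L \<Longrightarrow> i \<in> Field k \<Longrightarrow> |a \<alpha> i| <o R i"
    and mono: "\<And>\<alpha> i j. (i, j) \<in> k \<Longrightarrow> a \<alpha> i \<subseteq> a \<alpha> j"
    and un: "\<And>\<alpha> \<beta>. lt L \<beta> \<alpha> \<Longrightarrow> \<exists>i\<in>Field k. \<beta> \<in> a \<alpha> i"
  obtains f where "\<And>\<alpha> i. \<alpha> \<in> Field L \<Longrightarrow> i \<in> Field k \<Longrightarrow> f \<alpha> i \<in> Field (R i)"
    "\<And>A. A \<subseteq> Field L \<Longrightarrow> L \<le>o |A| \<Longrightarrow> \<exists>B i0. B \<subseteq> A \<and> i0 \<in> Field k \<and> cardSuc k \<le>o |B| \<and>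
       (\<forall>\<alpha>\<in>B. \<forall>\<beta>\<in>B. \<alpha> \<noteq> \<beta> \<longrightarrow> (\<forall>i. (i0, i) \<in> k \<longrightarrow> f \<alpha> i \<noteq> f \<beta> i))"
proof -
  have kco: "Card_order k" and kcinf: "Cinfinite k" and kwo: "Well_order k" using k Card_order_wo by blast+
  have tco: "Card_order t" and two: "Well_order t" using t Card_order_wo by blast+
  have Lco: "Card_order L" and Lcinf: "Cinfinite L" and Lwo: "Well_order L" using L Card_order_wo by blast+
  have k': "Reg (cardSuc k)" using Reg_cardSuc[OF kcinf] .
  then have k'co: "Card_order (cardSuc k)" by blast
  have kk': "k <o cardSuc k" using cardSuc_greater[OF kco] .
  have "k <o t"
    by (rule ordLess_transitive[OF ordLess_transitive[OF kk' cardSuc_greater[OF k'co]] t(2)])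
  then have natt: "natLeq <o t" by (rule ordLeq_ordLess_trans[OF natLeq_ordLeq_cinfinite[OF kcinf]])
  have kF: "(i, j) \<in> k \<Longrightarrow> j \<in> Field k" for i j by (auto simp: Field_def)

  define cofin where "cofin \<delta> E \<longleftrightarrow> E \<subseteq> {x. lt L x \<delta>} \<and> |E| \<le>o t \<and>
    (\<forall>x. lt L x \<delta> \<longrightarrow> (\<exists>y\<in>E. (x, y) \<in> L))" for \<delta> E
  define E' where "E' \<delta> = (if Ex (cofin \<delta>) then SOME E. cofin \<delta> E else {})" for \<delta>
  have E': "cofin \<delta> (E' \<delta>)" if "cofin \<delta> E" for \<delta> E
    using that someI_ex[of "cofin \<delta>"] unfolding E'_def by auto
  have E'0: "E' \<delta> \<subseteq> {x. lt L x \<delta>} \<and> |E' \<delta>| \<le>o t" for \<delta>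
  proof (cases "Ex (cofin \<delta>)")
    case True
    then have "cofin \<delta> (E' \<delta>)" using E' by blast
    then show ?thesis by (simp add: cofin_def)
  next
    case False
    then have "E' \<delta> = {}" unfolding E'_def by (rule if_not_P)
    then show ?thesis using Card_order_empty[OF tco] by simp
  qed
  \<comment> \<open>The strict suprema of the initial parts of \<open>E' \<delta>\<close> catch
    every point below \<open>\<delta>\<close> under which \<open>E' \<delta>\<close> is cofinal,
    whatever sequence leads to that point. There are at most \<open>t\<close> of them, few enough
    for the recursion in each \<open>R i\<close>.\<close>
  define E where "E \<delta> = (\<lambda>e. ssup L {y \<in> E' \<delta>. lt L y e}) ` E' \<delta>" for \<delta>
  have Et: "|E \<delta>| \<le>o t" for \<delta>
    unfolding E_def by (rule ordLeq_transitive[OF card_of_image]) (use E'0 in blast)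
  have Elt: "lt L x \<delta>" if "x \<in> E \<delta>" for x \<delta>
  proof -
    obtain e where e: "e \<in> E' \<delta>" "x = ssup L {y \<in> E' \<delta>. lt L y e}" using \<open>x \<in> E \<delta>\<close> unfolding E_def by blast
    have ed: "lt L e \<delta>" using e(1) E'0 by blast
    have "(x, e) \<in> L" unfolding e(2) by (rule ssup(3)[OF Lwo lt_Field(1)[OF ed]]) simp
    then show ?thesis using le_lt_trans[OF Lwo _ ed] by blast
  qed

  define ab where "ab \<alpha> i = {\<beta> \<in> a \<alpha> i \<union> E \<alpha>. lt L \<beta> \<alpha>}" for \<alpha> i
  obtain f where f: "\<And>\<alpha>. \<alpha> \<in> Field L \<Longrightarrow>
      \<forall>i\<in>Field k. f \<alpha> i \<in> Field (R i) \<and> (\<forall>\<beta>\<in>ab \<alpha> i. lt (R i) (f \<beta> i) (f \<alpha> i))"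
  proof (rule wo_choice[OF Lwo, where P = "\<lambda>f \<alpha> y.
      \<forall>i\<in>Field k. y i \<in> Field (R i) \<and> (\<forall>\<beta>\<in>ab \<alpha> i. lt (R i) (f \<beta> i) (y i))"])
    fix f g :: "'c \<Rightarrow> 'b \<Rightarrow> 'e" and x y
    assume "\<And>z. lt L z x \<Longrightarrow> f z = g z"
    then have "f \<beta> = g \<beta>" if "\<beta> \<in> ab x i" for \<beta> i using that by (simp add: ab_def)
    then show "(\<forall>i\<in>Field k. y i \<in> Field (R i) \<and> (\<forall>\<beta>\<in>ab x i. lt (R i) (f \<beta> i) (y i))) =
      (\<forall>i\<in>Field k. y i \<in> Field (R i) \<and> (\<forall>\<beta>\<in>ab x i. lt (R i) (g \<beta> i) (y i)))" by simp
  next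
    fix \<alpha> and f :: "'c \<Rightarrow> 'b \<Rightarrow> 'e"
    assume al: "\<alpha> \<in> Field L" and IH: "\<And>y. lt L y \<alpha> \<Longrightarrow>
      \<forall>i\<in>Field k. f y i \<in> Field (R i) \<and> (\<forall>\<beta>\<in>ab y i. lt (R i) (f \<beta> i) (f y i))"
    have "\<exists>b. b \<in> Field (R i) \<and> (\<forall>\<beta>\<in>ab \<alpha> i. lt (R i) (f \<beta> i) b)" if i: "i \<in> Field k" for i
    proof -
      have Ri: "Reg (R i)" "t <o R i" using R[OF i] by blast+
      then have Rinf: "infinite (Field (R i))" and Rco: "Card_order (R i)" by (auto simp: cinfinite_def)
      have "ab \<alpha> i \<subseteq> a \<alpha> i \<union> E \<alpha>" unfolding ab_def by blast
      then have 1: "|ab \<alpha> i| \<le>o |a \<alpha> i \<union> E \<alpha>|" by (rule card_of_mono1)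
      have 2: "|a \<alpha> i \<union> E \<alpha>| <o R i"
        by (rule card_of_Un_ordLess_infinite_Field[OF Rinf Rco a[OF al i] ordLeq_ordLess_trans[OF Et Ri(2)]])
      have 3: "|(\<lambda>\<beta>. f \<beta> i) ` ab \<alpha> i| <o R i"
        by (rule ordLeq_ordLess_trans[OF card_of_image ordLeq_ordLess_trans[OF 1 2]])
      have "(\<lambda>\<beta>. f \<beta> i) ` ab \<alpha> i \<subseteq> Field (R i)"
        using IH i unfolding ab_def by blast
      from Reg_bounded[OF Ri(1) this 3] show ?thesis by blast
    qed
    then show "\<exists>y. \<forall>i\<in>Field k. y i \<in> Field (R i) \<and> (\<forall>\<beta>\<in>ab \<alpha> i. lt (R i) (f \<beta> i) (y i))" by metis
  qed blast
  have fF: "f \<alpha> i \<in> Field (R i)" if "\<alpha> \<in> Field L" "i \<in> Field k" for \<alpha> i using f that by blast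
  have fE: "lt (R i) (f \<beta> i) (f \<alpha> i)" if "\<beta> \<in> E \<alpha>" "i \<in> Field k" for \<alpha> \<beta> i
  proof -
    note l = Elt[OF that(1)]
    have "\<beta> \<in> ab \<alpha> i" using that l unfolding ab_def by blast
    then show ?thesis using f[OF lt_Field(2)[OF l]] that(2) by blast
  qed
  have ev: "\<exists>i0\<in>Field k. \<forall>i. (i0, i) \<in> k \<longrightarrow> lt (R i) (f \<beta> i) (f \<alpha> i)" if l: "lt L \<beta> \<alpha>" for \<alpha> \<beta>
  proof -
    obtain i0 where i0: "i0 \<in> Field k" "\<beta> \<in> a \<alpha> i0" using un[OF l] by blast
    have "lt (R i) (f \<beta> i) (f \<alpha> i)" if "(i0, i) \<in> k" for i
    proof -
      have "\<beta> \<in> ab \<alpha> i" using mono[OF that] i0(2) l unfolding ab_def by blast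
      then show ?thesis using f[OF lt_Field(2)[OF l]] kF[OF that] by blast
    qed
    then show ?thesis using i0(1) by blast
  qed
  have Rtrans: "lt (R i) x z" if "lt (R i) x y" "lt (R i) y z" "i \<in> Field k" for i x y z
    using lt_trans[OF Card_order_wo, of "R i" x y z] R[OF that(3)] that(1,2) by simp
  obtain kz where kz: "kz \<in> Field k" using kcinf unfolding cinfinite_def by fastforce

  obtain \<C> where Ct: "|\<C>| \<le>o t"
    and C: "\<And>C. C \<in> \<C> \<Longrightarrow> C \<subseteq> Field t \<and> cardSuc k \<le>o |C| \<and> (\<forall>x\<in>C. \<exists>y\<in>C. lt t x y)"
    and guess: "\<And>G. club t G \<Longrightarrow> \<exists>C\<in>\<C>. C \<subseteq> G"
    using club_guessing[OF t(1) natt k' t(2)] by blast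

  show ?thesis
  proof (rule that[of f])
    fix A assume A: "A \<subseteq> Field L" "L \<le>o |A|"
    have unb: "\<exists>y\<in>A. lt L x y" if x: "x \<in> Field L" for x
    proof (rule ccontr)
      assume "\<not> ?thesis"
      then have "A \<subseteq> {y. (y, x) \<in> L}" using not_lt[OF Lwo x] A(1) by blast
      then have "|A| <o L" by (rule ordLeq_ordLess_trans[OF card_of_mono1 initial_small_le[OF Lcinf x]])
      then show False using A(2) not_ordLess[OF Lco] by blast
    qed
    define X where "X b \<nu> = ssup L (b ` {\<mu>. lt t \<mu> \<nu>})" for b :: "'d \<Rightarrow> 'c" and \<nu>
    \<comment> \<open>One \<open>i0\<close> has to serve all \<open>\<eta>\<close>, although two
      functions by themselves are only eventually ordered. With \<open>\<eta>\<close> at most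
      \<open>\<nu>\<close>, the relation depends only on values of \<open>b\<close> below
      \<open>\<nu>\<close>.\<close>
    define dom where "dom b \<nu> C y \<longleftrightarrow> (\<exists>i0\<in>Field k. \<forall>i. (i0, i) \<in> k \<longrightarrow>
      (\<forall>\<eta>\<in>C. (\<eta>, \<nu>) \<in> t \<longrightarrow> lt (R i) (f (X b \<eta>) i) (f y i)))" for b \<nu> C y
    have dom_mono: "dom b \<nu> C z" if d: "dom b \<nu> C y" and l: "lt L y z" for b \<nu> C y z
    proof -
      obtain i0 where i0: "i0 \<in> Field k" "\<And>i \<eta>. (i0, i) \<in> k \<Longrightarrow> \<eta> \<in> C \<Longrightarrow> (\<eta>, \<nu>) \<in> t \<Longrightarrow>
         lt (R i) (f (X b \<eta>) i) (f y i)" using d unfolding dom_def by blast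
      obtain i1 where i1: "i1 \<in> Field k" "\<And>i. (i1, i) \<in> k \<Longrightarrow> lt (R i) (f y i) (f z i)" using ev[OF l] by blast
      obtain m where m: "(i0, m) \<in> k" "(i1, m) \<in> k" using max_ex[OF kwo i0(1) i1(1)] .
      have "lt (R i) (f (X b \<eta>) i) (f z i)" if "(m, i) \<in> k" "\<eta> \<in> C" "(\<eta>, \<nu>) \<in> t" for i \<eta>
        using Rtrans[OF i0(2)[OF le_trans[OF kwo m(1) that(1)] that(2,3)] i1(2)[OF le_trans[OF kwo m(2) that(1)]] kF[OF that(1)]] .
      then show ?thesis using kF[OF m(1)] unfolding dom_def by blast
    qed
    \<comment> \<open>Which \<open>C\<close> will be guessed is known only when \<open>b\<close> is
      complete, so every stage provides for all of them. This is possible because anything above a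
      dominating index dominates too, and because \<open>|\<C>| \<le>o t\<close> and
      \<open>t <o L\<close>.\<close>
    define P where "P b \<nu> y \<longleftrightarrow> y \<in> A \<and> lt L (X b \<nu>) y \<and>
      (\<forall>C\<in>\<C>. (\<exists>\<zeta>\<in>Field L. dom b \<nu> C \<zeta>) \<longrightarrow> dom b \<nu> C y)" for b \<nu> y
    obtain b where b: "\<And>\<nu>. \<nu> \<in> Field t \<Longrightarrow> P b \<nu> (b \<nu>)"
    proof (rule wo_choice[OF two, where P = P])
      fix b b' :: "'d \<Rightarrow> 'c" and \<nu> y
      assume eq: "\<And>z. lt t z \<nu> \<Longrightarrow> b z = b' z"
      have "X b \<eta> = X b' \<eta>" if "(\<eta>, \<nu>) \<in> t" for \<eta>
      proof -
        have "b ` {\<mu>. lt t \<mu> \<eta>} = b' ` {\<mu>. lt t \<mu> \<eta>}"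
          using eq lt_le_trans[OF two _ that] by (intro image_cong) auto
        then show ?thesis by (simp add: X_def)
      qed
      then have 1: "dom b \<nu> C z = dom b' \<nu> C z" for C z unfolding dom_def by (metis (lifting))
      have "X b \<nu> = X b' \<nu>"
        unfolding X_def using eq by (intro arg_cong[where f = "ssup L"] image_cong) auto
      then show "P b \<nu> y = P b' \<nu> y" unfolding P_def by (simp add: 1)
    next
      fix \<nu> and b :: "'d \<Rightarrow> 'c"
      assume nu: "\<nu> \<in> Field t" and IH: "\<And>y. lt t y \<nu> \<Longrightarrow> P b y (b y)"
      let ?Y = "b ` {\<mu>. lt t \<mu> \<nu>}"
      have YF: "?Y \<subseteq> Field L" using IH A(1) unfolding P_def by blast
      have "|?Y| <o L"
        by (rule ordLess_transitive[OF ordLeq_ordLess_trans[OF card_of_image initial_small[OF tco nu]] L(2)])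
      from Reg_bounded[OF L(1) YF this] obtain u where u: "u \<in> Field L" "\<forall>x\<in>?Y. lt L x u" by blast
      have XF: "X b \<nu> \<in> Field L" unfolding X_def by (rule ssup(1)[OF Lwo u])
      define z where "z C = (if \<exists>\<zeta>\<in>Field L. dom b \<nu> C \<zeta> then SOME \<zeta>. \<zeta> \<in> Field L \<and> dom b \<nu> C \<zeta> else X b \<nu>)" for C
      have z: "dom b \<nu> C (z C)" "z C \<in> Field L" if "\<exists>\<zeta>\<in>Field L. dom b \<nu> C \<zeta>" for C
      proof -
        have ex: "\<exists>\<zeta>. \<zeta> \<in> Field L \<and> dom b \<nu> C \<zeta>" using that by blast
        show "dom b \<nu> C (z C)" "z C \<in> Field L" unfolding z_def using someI_ex[OF ex] that by simp_all
      qed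
      have zF: "z ` \<C> \<subseteq> Field L"
      proof
        fix x assume "x \<in> z ` \<C>"
        then obtain C where "x = z C" by blast
        then show "x \<in> Field L" using z(2)[of C] XF by (cases "\<exists>\<zeta>\<in>Field L. dom b \<nu> C \<zeta>") (simp, simp add: z_def)
      qed
      have "|z ` \<C>| <o L" by (rule ordLeq_ordLess_trans[OF card_of_image ordLeq_ordLess_trans[OF Ct L(2)]])
      from Reg_bounded[OF L(1) zF this] obtain v where v: "v \<in> Field L" "\<forall>x\<in>z ` \<C>. lt L x v" by blast
      obtain m where m: "(X b \<nu>, m) \<in> L" "(v, m) \<in> L" using max_ex[OF Lwo XF v(1)] .
      have mF: "m \<in> Field L" using m(1) by (auto simp: Field_def)
      obtain y where y: "y \<in> A" "lt L m y" using unb[OF mF] by blast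
      have "lt L (z C) y" if "C \<in> \<C>" for C
        using v(2) that lt_trans[OF Lwo lt_le_trans[OF Lwo _ m(2)] y(2)] by blast
      then have "dom b \<nu> C y" if "C \<in> \<C>" "\<exists>\<zeta>\<in>Field L. dom b \<nu> C \<zeta>" for C
        using dom_mono[OF z(1)[OF that(2)]] that(1) by blast
      then show "\<exists>y. P b \<nu> y" using y(1) le_lt_trans[OF Lwo m(1) y(2)] unfolding P_def by blast
    qed blast
    define \<xi> where "\<xi> = X b"
    have bA: "b \<nu> \<in> A" if "\<nu> \<in> Field t" for \<nu> using b[OF that] by (simp add: P_def)
    have bF: "b \<nu> \<in> Field L" if "\<nu> \<in> Field t" for \<nu> using bA[OF that] A(1) by blast
    then have bF': "\<forall>\<nu>\<in>Field t. b \<nu> \<in> Field L" by blast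
    have xib: "lt L (\<xi> \<nu>) (b \<nu>)" if "\<nu> \<in> Field t" for \<nu> using b[OF that] by (simp add: P_def \<xi>_def)
    have xiF: "\<xi> \<nu> \<in> Field L" if "\<nu> \<in> Field t" for \<nu> using lt_Field(1)[OF xib[OF that]] .
    then have xiF': "\<forall>\<nu>\<in>Field t. \<xi> \<nu> \<in> Field L" by blast
    have bd: "\<exists>u\<in>Field L. \<forall>x\<in>g ` Y. lt L x u" if "Y \<subseteq> Field t" "\<forall>\<nu>\<in>Field t. g \<nu> \<in> Field L" for g Y
    proof (rule Reg_bounded[OF L(1)])
      show "g ` Y \<subseteq> Field L" using that by blast
      show "|g ` Y| <o L"
        by (rule ordLeq_ordLess_trans[OF card_of_image ordLeq_ordLess_trans[OF card_of_ordLeq_Field[OF tco that(1)] L(2)]])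
    qed
    have bxi: "lt L (b \<mu>) (\<xi> \<nu>)" if "lt t \<mu> \<nu>" for \<mu> \<nu>
    proof -
      have "{\<mu>. lt t \<mu> \<nu>} \<subseteq> Field t" using lt_Field(1) by fast
      from bd[OF this bF'] obtain u where u: "u \<in> Field L" "\<forall>x\<in>b ` {\<mu>. lt t \<mu> \<nu>}. lt L x u" by blast
      show ?thesis unfolding \<xi>_def X_def by (rule ssup(2)[OF Lwo u]) (use that in blast)
    qed
    have xi_cof: "\<exists>\<mu>. lt t \<mu> \<nu> \<and> (x, b \<mu>) \<in> L" if "lt L x (\<xi> \<nu>)" for x \<nu>
    proof -
      have s: "{\<mu>. lt t \<mu> \<nu>} \<subseteq> Field t" using lt_Field(1) by fast
      from bd[OF s bF'] obtain u where u: "u \<in> Field L" "\<forall>x\<in>b ` {\<mu>. lt t \<mu> \<nu>}. lt L x u" by blast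
      have "b ` {\<mu>. lt t \<mu> \<nu>} \<subseteq> Field L" using s bF by blast
      from lt_ssup[OF Lwo u that[unfolded \<xi>_def X_def] this] show ?thesis by blast
    qed
    have xi_mono: "lt L (\<xi> \<mu>) (\<xi> \<nu>)" if "lt t \<mu> \<nu>" for \<mu> \<nu>
      using lt_trans[OF Lwo xib[OF lt_Field(1)[OF that]] bxi[OF that]] .
    have xi_le: "(\<xi> \<mu>, \<xi> \<nu>) \<in> L" if "(\<mu>, \<nu>) \<in> t" for \<mu> \<nu>
    proof (cases "\<mu> = \<nu>")
      case True
      have "\<nu> \<in> Field t" using that by (auto simp: Field_def)
      then show ?thesis using True le_refl[OF Lwo xiF] by simp
    next
      case False
      then show ?thesis using xi_mono[of \<mu> \<nu>] that by (simp add: lt_def)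
    qed
    obtain u where u: "u \<in> Field L" "\<forall>x\<in>\<xi> ` Field t. lt L x u" using bd[OF subset_refl xiF'] by blast
    define \<delta> where "\<delta> = ssup L (\<xi> ` Field t)"
    note d = ssup[OF Lwo u, folded \<delta>_def]
    have d_cof: "\<exists>\<nu>\<in>Field t. (x, \<xi> \<nu>) \<in> L" if "lt L x \<delta>" for x
      using lt_ssup[OF Lwo u that[unfolded \<delta>_def]] xiF by blast
    have "cofin \<delta> (\<xi> ` Field t)"
      unfolding cofin_def
    proof (intro conjI allI impI)
      show "\<xi> ` Field t \<subseteq> {x. lt L x \<delta>}" using d(2) by blast
      show "|\<xi> ` Field t| \<le>o t"
        by (rule ordLeq_transitive[OF card_of_image card_of_ordLeq_Field[OF tco subset_refl]])
      show "\<exists>y\<in>\<xi> ` Field t. (x, y) \<in> L" if "lt L x \<delta>" for x using d_cof[OF that] by blast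
    qed
    then have "cofin \<delta> (E' \<delta>)" by (rule E')
    then have E'lt: "\<And>y. y \<in> E' \<delta> \<Longrightarrow> lt L y \<delta>" and E'cof: "\<And>x. lt L x \<delta> \<Longrightarrow> \<exists>y\<in>E' \<delta>. (x, y) \<in> L"
      unfolding cofin_def by blast+
    have E'F: "E' \<delta> \<subseteq> Field L" using E'lt lt_Field(1) by fast
    \<comment> \<open>Two cofinal sets in \<delta>, the arbitrary \<open>E' \<delta>\<close> and the
      continuous sequence \<xi>, have common limits on a club of indices.\<close>
    define G where "G = {\<nu> \<in> Field t. \<forall>x. lt L x (\<xi> \<nu>) \<longrightarrow> (\<exists>y\<in>E' \<delta>. (x, y) \<in> L \<and> lt L y (\<xi> \<nu>))}"
    have G_E: "\<xi> \<nu> \<in> E \<delta>" if nu: "\<nu> \<in> G" for \<nu>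
    proof -
      have nF: "\<nu> \<in> Field t" using nu by (simp add: G_def)
      have "lt L (\<xi> \<nu>) \<delta>" using d(2) nF by blast
      then have ne: "{e \<in> E' \<delta>. (\<xi> \<nu>, e) \<in> L} \<noteq> {}" using E'cof by blast
      obtain e where e: "e \<in> E' \<delta>" "(\<xi> \<nu>, e) \<in> L" "\<And>y. y \<in> E' \<delta> \<Longrightarrow> (\<xi> \<nu>, y) \<in> L \<Longrightarrow> (e, y) \<in> L"
        by (rule least_ex[OF Lwo _ ne]) (use E'F in auto)
      have "lt L y e \<longleftrightarrow> lt L y (\<xi> \<nu>)" if y: "y \<in> E' \<delta>" for y
      proof
        assume "lt L y e"
        then have "(\<xi> \<nu>, y) \<notin> L" using e(3)[OF y] lt_asym[OF Lwo] by blast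
        then show "lt L y (\<xi> \<nu>)" using not_le[OF Lwo xiF[OF nF]] y E'F by blast
      qed (rule lt_le_trans[OF Lwo _ e(2)])
      then have eq: "{y \<in> E' \<delta>. lt L y e} = {y \<in> E' \<delta>. lt L y (\<xi> \<nu>)}" by blast
      let ?Y = "{y \<in> E' \<delta>. lt L y (\<xi> \<nu>)}"
      have b: "\<xi> \<nu> \<in> Field L" "\<forall>y\<in>?Y. lt L y (\<xi> \<nu>)" using xiF[OF nF] by auto
      note s = ssup[OF Lwo b]
      have "\<not> lt L (ssup L ?Y) (\<xi> \<nu>)"
      proof
        assume "lt L (ssup L ?Y) (\<xi> \<nu>)"
        then obtain y where "y \<in> ?Y" "(ssup L ?Y, y) \<in> L" using nu unfolding G_def by blast
        then show False using s(2)[of y] lt_asym[OF Lwo] by blast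
      qed
      then have "ssup L ?Y = \<xi> \<nu>" using s(3) by (simp add: lt_def)
      then show ?thesis unfolding E_def using e(1) eq by (metis (no_types, lifting) imageI)
    qed
    have "club t G"
      unfolding club_def
    proof (intro conjI ballI)
      show "G \<subseteq> Field t" unfolding G_def by blast
    next
      fix \<nu>0 assume n0: "\<nu>0 \<in> Field t"
      have step: "\<exists>\<nu>'. lt t \<nu> \<nu>' \<and> (\<exists>y\<in>E' \<delta>. (\<xi> \<nu>, y) \<in> L \<and> lt L y (\<xi> \<nu>'))" if n: "\<nu> \<in> Field t" for \<nu>
      proof -
        have "lt L (\<xi> \<nu>) \<delta>" using d(2) n by blast
        then obtain y where y: "y \<in> E' \<delta>" "(\<xi> \<nu>, y) \<in> L" using E'cof by blast
        obtain \<nu>1 where n1: "\<nu>1 \<in> Field t" "(y, \<xi> \<nu>1) \<in> L" using d_cof[OF E'lt[OF y(1)]] by blast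
        obtain m where m: "(\<nu>, m) \<in> t" "(\<nu>1, m) \<in> t" using max_ex[OF two n n1(1)] .
        have "m \<in> Field t" using m by (auto simp: Field_def)
        then obtain m' where m': "lt t m m'" using succ_ex[of t m] t(1) by blast
        have "lt L y (\<xi> m')" using le_lt_trans[OF Lwo n1(2) xi_mono[OF le_lt_trans[OF two m(2) m']]] .
        then show ?thesis using y le_lt_trans[OF two m(1) m'] by blast
      qed
      obtain \<beta> s where be: "\<beta> 0 = \<nu>0" "\<And>n. \<beta> n \<in> Field t" "\<And>n. lt t (\<beta> n) (\<beta> (Suc n))"
        "\<And>n. \<exists>y\<in>E' \<delta>. (\<xi> (\<beta> n), y) \<in> L \<and> lt L y (\<xi> (\<beta> (Suc n)))"
        and s: "s \<in> Field t" "\<And>n. lt t (\<beta> n) s" "\<And>x. lt t x s \<Longrightarrow> \<exists>n. (x, \<beta> n) \<in> t"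
        by (rule omega_limit[OF t(1) natt n0 step]) (assumption, rule that)
      have "\<exists>y\<in>E' \<delta>. (x, y) \<in> L \<and> lt L y (\<xi> s)" if x: "lt L x (\<xi> s)" for x
      proof -
        obtain \<mu> where mu: "lt t \<mu> s" "(x, b \<mu>) \<in> L" using xi_cof[OF x] by blast
        obtain n where n: "(\<mu>, \<beta> n) \<in> t" using s(3)[OF mu(1)] by blast
        have "lt L (b \<mu>) (\<xi> (\<beta> (Suc n)))" using bxi[OF le_lt_trans[OF two n be(3)]] .
        then have 1: "lt L x (\<xi> (\<beta> (Suc n)))" using le_lt_trans[OF Lwo mu(2)] by blast
        obtain y where y: "y \<in> E' \<delta>" "(\<xi> (\<beta> (Suc n)), y) \<in> L" "lt L y (\<xi> (\<beta> (Suc (Suc n))))" using be(4) by blast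
        have "(x, y) \<in> L" using lt_le_trans[OF Lwo 1 y(2)] lt_imp_le by fast
        moreover have "lt L y (\<xi> s)" using lt_trans[OF Lwo y(3) xi_mono[OF s(2)]] .
        ultimately show ?thesis using y(1) by blast
      qed
      then have "s \<in> G" using s(1) unfolding G_def by blast
      moreover have "lt t \<nu>0 s" using s(2)[of 0] be(1) by simp
      ultimately show "\<exists>g\<in>G. lt t \<nu>0 g" by blast
    next
      fix c assume c: "c \<in> Field t"
      let ?U = "{m \<in> Field t. \<forall>x\<in>G. (x, c) \<in> t \<longrightarrow> (x, m) \<in> t}"
      have cU: "c \<in> ?U" using c by auto
      obtain g where g: "g \<in> ?U" "\<And>x. x \<in> ?U \<Longrightarrow> (g, x) \<in> t"
        by (rule least_ex[OF two, of ?U]) (use cU in auto)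
      have "\<exists>y\<in>E' \<delta>. (x, y) \<in> L \<and> lt L y (\<xi> g)" if x: "lt L x (\<xi> g)" for x
      proof -
        obtain \<mu> where mu: "lt t \<mu> g" "(x, b \<mu>) \<in> L" using xi_cof[OF x] by blast
        have muF: "\<mu> \<in> Field t" using lt_Field(1)[OF mu(1)] .
        have "\<mu> \<notin> ?U" using g(2) mu(1) lt_asym[OF two] by blast
        then obtain g' where g': "g' \<in> G" "(g', c) \<in> t" "(g', \<mu>) \<notin> t" using muF by blast
        have "lt t \<mu> g'" using not_le[OF two _ muF g'(3)] g'(1) unfolding G_def by blast
        then have "lt L x (\<xi> g')" using le_lt_trans[OF Lwo mu(2) bxi] by blast
        then obtain y where y: "y \<in> E' \<delta>" "(x, y) \<in> L" "lt L y (\<xi> g')" using g'(1) unfolding G_def by blast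
        have "(g', g) \<in> t" using g(1) g'(1,2) by blast
        then show ?thesis using y lt_le_trans[OF Lwo y(3) xi_le] by blast
      qed
      then have "g \<in> G" using g(1) unfolding G_def by blast
      then show "\<exists>g\<in>G. (g, c) \<in> t \<and> (\<forall>g'\<in>G. (g', c) \<in> t \<longrightarrow> (g', g) \<in> t)"
        using g(1) g(2)[OF cU] by blast
    qed
    from guess[OF this] obtain C where CC: "C \<in> \<C>" "C \<subseteq> G" by blast
    have CF: "C \<subseteq> Field t" and Ck: "cardSuc k \<le>o |C|" and Cnm: "\<And>x. x \<in> C \<Longrightarrow> \<exists>y\<in>C. lt t x y"
      using C[OF CC(1)] by blast+
    have "\<exists>nx j. nx \<in> C \<and> j \<in> Field k \<and> (\<forall>y\<in>C. lt t \<nu> y \<longrightarrow> (nx, y) \<in> t) \<and>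
        (\<forall>i. (j, i) \<in> k \<longrightarrow> (\<forall>\<eta>\<in>C. (\<eta>, \<nu>) \<in> t \<longrightarrow> lt (R i) (f (\<xi> \<eta>) i) (f (b \<nu>) i)) \<and>
           lt (R i) (f (b \<nu>) i) (f (\<xi> nx) i))" if nu: "\<nu> \<in> C" for \<nu>
    proof -
      \<comment> \<open>For indices in \<open>C\<close> the points of the sequence belong to
        \<open>E \<delta>\<close>, so \<delta> dominates them without any exceptional
        \<open>i\<close>. This witness makes the provision in \<open>P\<close> take effect for the
        member \<open>b \<nu>\<close> of \<open>A\<close>.\<close>
      have "dom b \<nu> C \<delta>"
        unfolding dom_def using kz fE[OF G_E] CC(2) kF unfolding \<xi>_def by blast
      then have "dom b \<nu> C (b \<nu>)" using b[of \<nu>] nu CF CC(1) d(1) unfolding P_def by blast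
      then obtain i0 where i0: "i0 \<in> Field k"
        "\<And>i \<eta>. (i0, i) \<in> k \<Longrightarrow> \<eta> \<in> C \<Longrightarrow> (\<eta>, \<nu>) \<in> t \<Longrightarrow> lt (R i) (f (\<xi> \<eta>) i) (f (b \<nu>) i)"
        unfolding dom_def \<xi>_def by blast
      have ne: "{y \<in> C. lt t \<nu> y} \<noteq> {}" using Cnm[OF nu] by blast
      obtain nx where nx: "nx \<in> C" "lt t \<nu> nx" "\<And>y. y \<in> C \<Longrightarrow> lt t \<nu> y \<Longrightarrow> (nx, y) \<in> t"
        by (rule least_ex[OF two _ ne]) (use CF in auto)
      obtain i1 where i1: "i1 \<in> Field k" "\<And>i. (i1, i) \<in> k \<Longrightarrow> lt (R i) (f (b \<nu>) i) (f (\<xi> nx) i)"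
        using ev[OF bxi[OF nx(2)]] by blast
      obtain m where m: "(i0, m) \<in> k" "(i1, m) \<in> k" using max_ex[OF kwo i0(1) i1(1)] .
      show ?thesis
        by (rule exI[of _ nx], rule exI[of _ m])
          (use nx kF[OF m(1)] i0(2)[OF le_trans[OF kwo m(1)]] i1(2)[OF le_trans[OF kwo m(2)]] in blast)
    qed
    then obtain nx j where nxj: "\<And>\<nu>. \<nu> \<in> C \<Longrightarrow> nx \<nu> \<in> C \<and> j \<nu> \<in> Field k \<and> (\<forall>y\<in>C. lt t \<nu> y \<longrightarrow> (nx \<nu>, y) \<in> t) \<and>
        (\<forall>i. (j \<nu>, i) \<in> k \<longrightarrow> (\<forall>\<eta>\<in>C. (\<eta>, \<nu>) \<in> t \<longrightarrow> lt (R i) (f (\<xi> \<eta>) i) (f (b \<nu>) i)) \<and>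
           lt (R i) (f (b \<nu>) i) (f (\<xi> (nx \<nu>)) i))" by metis
    have "|Field k| <o cardSuc k"
      by (rule ordLeq_ordLess_trans[OF card_of_ordLeq_Field[OF kco subset_refl] kk'])
    from pigeonhole_stable[OF k'co Reg_stable[OF k'] this _ Ck, of j] nxj
    obtain i0 where i0: "i0 \<in> Field k" "cardSuc k \<le>o |{\<nu> \<in> C. j \<nu> = i0}|" by blast
    let ?C = "{\<nu> \<in> C. j \<nu> = i0}"
    have blt: "lt L (b \<mu>) (b \<nu>)" if "lt t \<mu> \<nu>" for \<mu> \<nu>
      using lt_trans[OF Lwo bxi[OF that] xib[OF lt_Field(2)[OF that]]] .
    have cmp: "lt t \<mu> \<nu> \<or> \<mu> = \<nu> \<or> lt t \<nu> \<mu>" if "\<mu> \<in> C" "\<nu> \<in> C" for \<mu> \<nu>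
      using not_lt[OF two, of \<mu> \<nu>] that CF by (auto simp: lt_def)
    have "inj_on b ?C"
    proof (rule inj_onI, rule ccontr)
      fix x y assume "x \<in> ?C" "y \<in> ?C" "b x = b y" "x \<noteq> y"
      then show False using cmp[of x y] blt[of x y] blt[of y x] by auto
    qed
    then have "|?C| \<le>o |b ` ?C|" by (rule card_of_ordLeqI) blast
    then have size: "cardSuc k \<le>o |b ` ?C|" by (rule ordLeq_transitive[OF i0(2)])
    have sub: "b ` ?C \<subseteq> A" using bA CF by blast
    \<comment> \<open>The next point of \<open>C\<close> separates the two:
      \<open>f (\<xi> (nx \<mu>)) i\<close> is above \<open>f (b \<mu>) i\<close> and is dominated
      by \<open>f (b \<nu>) i\<close>, both from the common \<open>i0\<close> on.\<close>
    have key: "f (b \<mu>) i \<noteq> f (b \<nu>) i" if m: "\<mu> \<in> ?C" and n: "\<nu> \<in> ?C" and l: "lt t \<mu> \<nu>" and i: "(i0, i) \<in> k" for \<mu> \<nu> i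
    proof -
      have mC: "\<mu> \<in> C" "j \<mu> = i0" and nC: "\<nu> \<in> C" "j \<nu> = i0" using m n by auto
      have 1: "lt (R i) (f (b \<mu>) i) (f (\<xi> (nx \<mu>)) i)" using nxj[OF mC(1)] mC(2) i by blast
      have 2: "nx \<mu> \<in> C" "(nx \<mu>, \<nu>) \<in> t" using nxj[OF mC(1)] nC(1) l by blast+
      have 3: "lt (R i) (f (\<xi> (nx \<mu>)) i) (f (b \<nu>) i)" using nxj[OF nC(1)] nC(2) 2 i by blast
      show ?thesis using Rtrans[OF 1 3 kF[OF i]] by auto
    qed
    have dist: "f \<alpha> i \<noteq> f \<beta> i" if "\<alpha> \<in> b ` ?C" "\<beta> \<in> b ` ?C" "\<alpha> \<noteq> \<beta>" "(i0, i) \<in> k" for \<alpha> \<beta> i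
    proof -
      obtain \<mu> \<nu> where "\<mu> \<in> ?C" "\<nu> \<in> ?C" "\<alpha> = b \<mu>" "\<beta> = b \<nu>" using \<open>\<alpha> \<in> b ` ?C\<close> \<open>\<beta> \<in> b ` ?C\<close> by blast
      moreover from this have "lt t \<mu> \<nu> \<or> lt t \<nu> \<mu>" using cmp[of \<mu> \<nu>] that(3) by auto
      ultimately show ?thesis using key[of \<mu> \<nu> i] key[of \<nu> \<mu> i] that(4) by metis
    qed
    show "\<exists>B i0. B \<subseteq> A \<and> i0 \<in> Field k \<and> cardSuc k \<le>o |B| \<and>
       (\<forall>\<alpha>\<in>B. \<forall>\<beta>\<in>B. \<alpha> \<noteq> \<beta> \<longrightarrow> (\<forall>i. (i0, i) \<in> k \<longrightarrow> f \<alpha> i \<noteq> f \<beta> i))"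
      by (intro exI[of _ "b ` ?C"] exI[of _ i0] conjI ballI impI allI) (fact sub i0(1) size | erule (3) dist)+
  qed (rule fF)
qed

section \<open>Covering at singular cardinals\<close>

text \<open>A member of \<open>P_less (cardSuc k)\<close> is here a set of size at most
  \<open>k\<close>. The family belongs to a set \<open>A\<close> instead of a cardinal, so that
  initial segments can be treated without being re-indexed.\<close>

definition covers :: "'b rel \<Rightarrow> 'a set \<Rightarrow> 'a set set \<Rightarrow> bool" where
  "covers k A X \<longleftrightarrow> (\<forall>x\<in>X. x \<subseteq> A \<and> |x| \<le>o k) \<and>
     (\<forall>a. a \<subseteq> A \<longrightarrow> |a| \<le>o k \<longrightarrow> (\<exists>Q\<subseteq>X. |Q| <o k \<and> a \<subseteq> \<Union>Q))"

definition coverable :: "'b rel \<Rightarrow> 'a set \<Rightarrow> 'c rel \<Rightarrow> bool" where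
  "coverable k A r \<longleftrightarrow> (\<exists>X. covers k A X \<and> |X| \<le>o r)"

section \<open>Unbounded subsets of \<open>k\<close>\<close>

definition unb :: "'b rel \<Rightarrow> 'b set \<Rightarrow> bool" where
  "unb k T \<longleftrightarrow> T \<subseteq> Field k \<and> (\<forall>b\<in>Field k. \<exists>i\<in>T. lt k b i)"

lemma unb_Un:
  assumes "Well_order k" "unb k (T1 \<union> T2)"
  shows "unb k T1 \<or> unb k T2"
proof (rule ccontr)
  assume "\<not> ?thesis"
  then obtain b1 b2 where b: "b1 \<in> Field k" "b2 \<in> Field k" "\<And>i. i \<in> T1 \<Longrightarrow> \<not> lt k b1 i" "\<And>i. i \<in> T2 \<Longrightarrow> \<not> lt k b2 i"
    using assms(2) unfolding unb_def by blast
  obtain m where m: "(b1, m) \<in> k" "(b2, m) \<in> k" using max_ex[OF assms(1) b(1,2)] .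
  have "m \<in> Field k" using m(1) by (auto simp: Field_def)
  then obtain i where "i \<in> T1 \<union> T2" "lt k m i" using assms(2) unfolding unb_def by blast
  then show False using b(3,4) le_lt_trans[OF assms(1) m(1)] le_lt_trans[OF assms(1) m(2)] by blast
qed

text \<open>Fewer than \<open>k\<close> members of \<open>Y\<close> cover the image of
  \<open>T\<close>, and a union of fewer than \<open>k\<close> bounded subsets of \<open>k\<close>
  is bounded. In this way covering by fewer than \<open>k\<close> sets, instead of one, is strong
  enough as an induction hypothesis.\<close>

lemma unb_covers:
  assumes k: "Reg k" and T: "unb k T" and h: "h ` T \<subseteq> D" and c: "covers k D Y"
  shows "\<exists>y\<in>Y. unb k {i \<in> T. h i \<in> y}"
proof (rule ccontr)
  assume n: "\<not> ?thesis"
  have kco: "Card_order k" and wo: "Well_order k" using k Card_order_wo by blast+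
  have TF: "T \<subseteq> Field k" using T by (simp add: unb_def)
  have "|h ` T| \<le>o k" by (rule ordLeq_transitive[OF card_of_image card_of_ordLeq_Field[OF kco TF]])
  from conjunct2[OF c[unfolded covers_def], rule_format, OF h this]
  obtain Q where Q: "Q \<subseteq> Y" "|Q| <o k" "h ` T \<subseteq> \<Union>Q" by blast
  have "\<exists>b. b \<in> Field k \<and> (\<forall>i\<in>T. h i \<in> y \<longrightarrow> \<not> lt k b i)" if y: "y \<in> Q" for y
  proof -
    have "\<not> unb k {i \<in> T. h i \<in> y}" using n subsetD[OF Q(1) y] by blast
    then show ?thesis using TF unfolding unb_def by auto
  qed
  then obtain b where b: "\<And>y. y \<in> Q \<Longrightarrow> b y \<in> Field k \<and> (\<forall>i\<in>T. h i \<in> y \<longrightarrow> \<not> lt k (b y) i)" by metis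
  have "b ` Q \<subseteq> Field k" using b by blast
  from Reg_bounded[OF k this ordLeq_ordLess_trans[OF card_of_image Q(2)]]
  obtain u where u: "u \<in> Field k" "\<forall>x\<in>b ` Q. lt k x u" by blast
  obtain i where i: "i \<in> T" "lt k u i" using T u(1) unfolding unb_def by blast
  obtain y where y: "y \<in> Q" "h i \<in> y" using Q(3) i(1) by blast
  have "lt k (b y) i" using u(2) y(1) lt_trans[OF wo _ i(2)] by blast
  then show False using b[OF y(1)] i(1) y(2) by blast
qed

text \<open>The form of Fodor's lemma that needs no stationary sets.\<close>

lemma regressive_unbounded:
  fixes k :: "'b rel"
  assumes k: "Reg k" "natLeq <o k"
    and P: "\<And>i. i \<in> Field k \<Longrightarrow> \<exists>z. lt k z i \<Longrightarrow> \<exists>j. lt k j i \<and> P i j"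
  shows "\<exists>j\<in>Field k. unb k {i \<in> Field k. P i j}"
proof (rule ccontr)
  assume n: "\<not> ?thesis"
  have kcinf: "Cinfinite k" and wo: "Well_order k" using k Card_order_wo by blast+
  have "\<exists>b. b \<in> Field k \<and> (\<forall>i\<in>Field k. P i j \<longrightarrow> \<not> lt k b i)" if j: "j \<in> Field k" for j
  proof -
    have "\<not> unb k {i \<in> Field k. P i j}" using n j by blast
    then show ?thesis unfolding unb_def by auto
  qed
  then obtain b where b: "\<And>j. j \<in> Field k \<Longrightarrow> b j \<in> Field k \<and> (\<forall>i\<in>Field k. P i j \<longrightarrow> \<not> lt k (b j) i)" by metis
  have step: "\<exists>y. lt k x y \<and> (\<forall>j. (j, x) \<in> k \<longrightarrow> lt k (b j) y)" if x: "x \<in> Field k" for x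
  proof -
    have "{j. (j, x) \<in> k} \<subseteq> Field k" by (auto simp: Field_def)
    then have "b ` {j. (j, x) \<in> k} \<subseteq> Field k" using b by blast
    from Reg_bounded[OF k(1) this ordLeq_ordLess_trans[OF card_of_image initial_small_le[OF kcinf x]]]
    obtain u where u: "u \<in> Field k" "\<forall>x\<in>b ` {j. (j, x) \<in> k}. lt k x u" by blast
    obtain m where m: "(x, m) \<in> k" "(u, m) \<in> k" using max_ex[OF wo x u(1)] .
    have "m \<in> Field k" using m(1) by (auto simp: Field_def)
    then obtain y where y: "lt k m y" using succ_ex[OF kcinf] by blast
    have "lt k (b j) y" if "(j, x) \<in> k" for j
      using u(2) that lt_trans[OF wo lt_le_trans[OF wo _ m(2)] y] by blast
    then show ?thesis using le_lt_trans[OF wo m(1) y] by blast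
  qed
  obtain z where z: "z \<in> Field k" using kcinf unfolding cinfinite_def by fastforce
  \<comment> \<open>The limit \<open>s\<close> is closed under the bounds \<open>b\<close>, so
    \<open>P s j\<close> with \<open>j\<close> below \<open>s\<close> contradicts
    \<open>lt k (b j) s\<close>.\<close>
  obtain \<beta> s where be: "\<beta> 0 = z" "\<And>n. \<beta> n \<in> Field k" "\<And>n. lt k (\<beta> n) (\<beta> (Suc n))"
    "\<And>n. \<forall>j. (j, \<beta> n) \<in> k \<longrightarrow> lt k (b j) (\<beta> (Suc n))"
    and s: "s \<in> Field k" "\<And>n. lt k (\<beta> n) s" "\<And>x. lt k x s \<Longrightarrow> \<exists>n. (x, \<beta> n) \<in> k"
    by (rule omega_limit[OF k z step]) (assumption, rule that)
  obtain j where j: "lt k j s" "P s j" using P[OF s(1)] s(2) by blast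
  obtain n where n: "(j, \<beta> n) \<in> k" using s(3)[OF j(1)] by blast
  have "lt k (b j) s" using be(4)[of n] n lt_trans[OF wo _ s(2)] by blast
  then show False using b[OF lt_Field(1)[OF j(1)]] s(1) j(2) by blast
qed

text \<open>A successor cardinal is regular; so \<open>m\<close>, having a cofinal subset of size at
  most \<open>r\<close>, cannot be \<open>cardSuc r\<close>.\<close>

lemma cofinal_cardSuc_ordLess:
  fixes m :: "'a rel"
  assumes m: "Card_order m" and r: "Cinfinite r" "r <o m"
    and X: "X \<subseteq> Field m" "|X| \<le>o r" "\<And>u. u \<in> Field m \<Longrightarrow> \<exists>x\<in>X. (u, x) \<in> m"
  shows "cardSuc r <o m"
proof (rule ccontr)
  assume n: "\<not> cardSuc r <o m"
  have rco: "Card_order r" using r(1) by blast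
  have sco: "Card_order (cardSuc r)" using cardSuc_Card_order[OF rco] .
  have "m \<le>o cardSuc r" using n Card_order_wo[OF m] Card_order_wo[OF sco] not_ordLess_iff_ordLeq by blast
  moreover have "cardSuc r \<le>o m" using cardSuc_ordLess_ordLeq[OF rco m] r(2) by blast
  ultimately have iso: "cardSuc r =o m" by (simp add: ordIso_iff_ordLeq)
  have "Reg (cardSuc r)" by (rule Reg_cardSuc[OF r(1)])
  then have "regularCard m" using regularCard_ordIso[OF iso] by blast
  moreover have "Cinfinite m" by (rule ordLess_Cinfinite_mono[OF r m])
  ultimately have mR: "Reg m" by blast
  obtain b where b: "b \<in> Field m" "\<forall>x\<in>X. lt m x b"
    using Reg_bounded[OF mR X(1) ordLeq_ordLess_trans[OF X(2) r(2)]] by blast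
  then show False using X(3)[OF b(1)] lt_asym[OF Card_order_wo[OF m]] by blast
qed

lemma ordLess_initial:
  assumes "Card_order r" "Card_order m" "r <o m"
  shows "\<exists>w\<in>Field m. r \<le>o |{x. lt m x w}|"
proof -
  note wo = Card_order_wo[OF assms(1)] Card_order_wo[OF assms(2)]
  obtain w where w: "w \<in> Field m" "r =o Restr m (underS m w)"
    using assms(3) ordLess_iff_ordIso_Restr[OF wo(2,1)] by blast
  have "|Field r| =o |Field (Restr m (underS m w))|" by (rule card_of_cong[OF w(2)])
  moreover have "Field (Restr m (underS m w)) \<subseteq> underS m w" by (auto simp: Field_def)
  ultimately have "|Field r| \<le>o |underS m w|" by (meson card_of_mono1 ordIso_ordLeq_trans)
  then have "r \<le>o |underS m w|"
    by (rule ordIso_ordLeq_trans[OF ordIso_symmetric[OF card_of_Field_ordIso[OF assms(1)]]])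
  then show ?thesis using w(1) by (auto simp: underS_lt)
qed

text \<open>Such injections provide the codes: a point below a given member of
  \<open>cardSuc r\<close> is coded by a point of \<open>r\<close>, and covering families for small
  parts of \<open>r\<close> then apply to the codes.\<close>

lemma cardSuc_initial_inj:
  assumes r: "Cinfinite r" and x: "x \<in> Field (cardSuc r)"
  shows "\<exists>e. inj_on e {y. (y, x) \<in> cardSuc r} \<and> e ` {y. (y, x) \<in> cardSuc r} \<subseteq> Field r"
proof -
  have rco: "Card_order r" using r by blast
  have "|{y. (y, x) \<in> cardSuc r}| <o cardSuc r"
    using initial_small_le[OF _ x] Reg_cardSuc[OF r] by blast
  then have "|{y. (y, x) \<in> cardSuc r}| \<le>o r" using cardSuc_ordLeq_ordLess[OF rco card_of_Card_order] by blast
  then have "|{y. (y, x) \<in> cardSuc r}| \<le>o |Field r|"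
    by (rule ordLeq_ordIso_trans[OF _ ordIso_symmetric[OF card_of_Field_ordIso[OF rco]]])
  then show ?thesis by (simp add: card_of_ordLeq)
qed

text \<open>
  A version of Silver's argument for covering numbers.  Instead of the value of the cardinal
  power at the initial pieces \<open>U i\<close> one uses covering families \<open>M i\<close> indexed by the successor of
  \<open>|U i|\<close>; a set \<open>a\<close> then determines a function \<open>F\<close>, which is compared with the members of a free
  family.  If \<open>F\<close> is often below some \<open>f \<alpha>\<close>, then \<open>a\<close> is covered by a set depending only on \<open>\<alpha>\<close>
  and few other parameters; otherwise large sets of indices would be squeezed into sets of size
  \<open>k\<close>, which the free family does not allow.
\<close>

lemma coverable_singular:
  fixes k :: "'b rel" and m :: "'a rel"
  assumes k: "Reg k" "natLeq <o k" and m: "Card_order m" "k <o m"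
    and c: "\<And>i. i \<in> Field k \<Longrightarrow> c i \<in> Field m" "\<And>u. u \<in> Field m \<Longrightarrow> \<exists>i\<in>Field k. (u, c i) \<in> m"
    and bdd: "\<And>X. X \<subseteq> Field m \<Longrightarrow> |X| <o k \<Longrightarrow> \<exists>b\<in>Field m. \<forall>x\<in>X. lt m x b"
    and cov: "\<And>u. u \<in> Field m \<Longrightarrow> coverable k {x. (x, u) \<in> m} m"
    and small: "\<And>V. V \<subseteq> Field m \<Longrightarrow> k \<le>o |V| \<Longrightarrow> |V| <o m \<Longrightarrow> \<exists>M :: 'a set \<Rightarrow> 'a set. (\<forall>\<xi>. |M \<xi>| <o k) \<and>
      (\<forall>x. x \<subseteq> V \<longrightarrow> |x| <o k \<longrightarrow> (\<exists>\<xi>\<in>Field (cardSuc |V| ). x \<subseteq> M \<xi>))"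
  shows "coverable k (Field m) (cardSuc m)"
proof -
  have kco: "Card_order k" and kcinf: "Cinfinite k" and kwo: "Well_order k" using k Card_order_wo by blast+
  have kinf: "infinite (Field k)" using kcinf by (simp add: cinfinite_def)
  have mwo: "Well_order m" using m Card_order_wo by blast
  have mcinf: "Cinfinite m" by (rule ordLess_Cinfinite_mono[OF kcinf m(2,1)])
  have kF: "(i, j) \<in> k \<Longrightarrow> i \<in> Field k \<and> j \<in> Field k" for i j by (auto simp: Field_def)
  have cs: "cardSuc r <o m" if "Cinfinite r" "r <o m" "k \<le>o r" for r
  proof (rule cofinal_cardSuc_ordLess[OF m(1) that(1,2)])
    show "c ` Field k \<subseteq> Field m" using c(1) by blast
    show "|c ` Field k| \<le>o r"
      by (rule ordLeq_transitive[OF ordLeq_transitive[OF card_of_image card_of_ordLeq_Field[OF kco subset_refl]] that(3)])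
    show "\<exists>x\<in>c ` Field k. (u, x) \<in> m" if "u \<in> Field m" for u using c(2)[OF that] by blast
  qed
  \<comment> \<open>Guessed sets have size \<open>?k1\<close>, so that one of \<open>k\<close>
    values is taken \<open>?k1\<close> times on them; guessing sets of this size requires
    \<open>?k2 <o ?t\<close>.\<close>
  let ?k1 = "cardSuc k" let ?k2 = "cardSuc ?k1" let ?t = "cardSuc ?k2"
  have k1: "Reg ?k1" by (rule Reg_cardSuc[OF kcinf])
  have k1co: "Card_order ?k1" using k1 by blast
  have k2: "Reg ?k2" by (rule Reg_cardSuc) (use k1 in blast)
  have k2co: "Card_order ?k2" using k2 by blast
  have t: "Reg ?t" by (rule Reg_cardSuc) (use k2 in blast)
  then have tco: "Card_order ?t" by blast
  have lt1: "k <o ?k1" using cardSuc_greater[OF kco] .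
  have lt2: "k <o ?k2" by (rule ordLess_transitive[OF lt1 cardSuc_greater[OF k1co]])
  have lt3: "?k2 <o ?t" by (rule cardSuc_greater[OF k2co])
  have kt: "k <o ?t" by (rule ordLess_transitive[OF lt2 lt3])
  have m1: "?k1 <o m" by (rule cs[OF kcinf m(2)]) (rule ordLeq_reflexive[OF kwo])
  have m2: "?k2 <o m" by (rule cs[OF _ m1 ordLess_imp_ordLeq[OF lt1]]) (use k1 in blast)
  have m3: "?t <o m" by (rule cs[OF _ m2 ordLess_imp_ordLeq[OF lt2]]) (use k2 in blast)
  obtain w where w: "w \<in> Field m" "?t \<le>o |{x. lt m x w}|" using ordLess_initial[OF tco m(1) m3] by blast
  have "\<exists>y. (w, y) \<in> m \<and> (c i, y) \<in> m" if "i \<in> Field k" for i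
    using max_ex[OF mwo w(1) c(1)[OF that]] by blast
  then obtain d where d: "\<And>i. i \<in> Field k \<Longrightarrow> (w, d i) \<in> m \<and> (c i, d i) \<in> m" by metis
  have dF: "d i \<in> Field m" if "i \<in> Field k" for i using d[OF that] by (auto simp: Field_def)
  define D where "D j = {x. (x, d j) \<in> m}" for j
  \<comment> \<open>Only \<open>D j\<close> with \<open>j\<close> strictly below \<open>i\<close>
    enter: a point of \<open>U i\<close> thus yields a smaller index, as pressing down requires. The
    segment of \<open>w\<close> makes every piece at least as large as \<open>?t\<close>, and it
    lies in each \<open>D j\<close>.\<close>
  define U where "U i = {x. (x, w) \<in> m \<or> (\<exists>j. lt k j i \<and> x \<in> D j)}" for i
  have UF: "U i \<subseteq> Field m" for i unfolding U_def D_def by (auto simp: Field_def)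
  have Um: "|U i| <o m" if i: "i \<in> Field k" for i
  proof -
    let ?X = "d ` {j. lt k j i} \<union> {w}"
    have X: "?X \<subseteq> Field m" using dF lt_Field(1) w(1) by fast
    have "|?X| <o k"
      by (rule card_of_Un_ordLess_infinite_Field[OF kinf kco
            ordLeq_ordLess_trans[OF card_of_image initial_small[OF kco i]] finite_ordLess[OF k(2)]]) simp
    from bdd[OF X this] obtain b where b: "b \<in> Field m" "\<forall>x\<in>?X. lt m x b" by blast
    have "U i \<subseteq> {x. (x, b) \<in> m}"
      using b(2) le_trans[OF mwo _ lt_imp_le] unfolding U_def D_def by blast
    then show ?thesis by (rule ordLeq_ordLess_trans[OF card_of_mono1 initial_small_le[OF mcinf b(1)]])
  qed
  have Ut: "?t \<le>o |U i|" for i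
    by (rule ordLeq_transitive[OF w(2) card_of_mono1]) (auto simp: U_def lt_def)
  have Uinf: "Cinfinite |U i|" for i
    using cinfinite_mono[OF Ut] t card_of_Card_order by blast
  have Umono: "U i \<subseteq> U j" if "(i, j) \<in> k" for i j
    unfolding U_def using lt_le_trans[OF kwo _ that] by blast
  have Uall: "\<exists>i\<in>Field k. u \<in> U i" if u: "u \<in> Field m" for u
  proof -
    obtain j where j: "j \<in> Field k" "(u, c j) \<in> m" using c(2)[OF u] by blast
    obtain i where i: "lt k j i" using succ_ex[OF kcinf j(1)] .
    have "u \<in> D j" unfolding D_def using d[OF j(1)] le_trans[OF mwo j(2)] by blast
    then show ?thesis using i lt_Field(2)[OF i] unfolding U_def by blast
  qed
  have Ureg: "\<exists>j. lt k j i \<and> u \<in> D j" if u: "u \<in> U i" and z: "lt k z i" for u i z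
  proof (cases "(u, w) \<in> m")
    case True
    then have "u \<in> D z" unfolding D_def using d[OF lt_Field(1)[OF z]] le_trans[OF mwo True] by blast
    then show ?thesis using z by blast
  next
    case False
    then show ?thesis using u unfolding U_def by blast
  qed

  define R where "R i = cardSuc |U i|" for i
  let ?L = "cardSuc m"
  have L: "Reg ?L" by (rule Reg_cardSuc[OF mcinf])
  have Lco: "Card_order ?L" using L by blast
  have mL: "m <o ?L" by (rule cardSuc_greater[OF m(1)])
  have R: "Reg (R i) \<and> ?t <o R i" for i
    unfolding R_def using Reg_cardSuc[OF Uinf] ordLeq_ordLess_trans[OF Ut cardSuc_greater[OF card_of_Card_order]] by blast
  have "\<exists>e. inj_on e {y. (y, \<alpha>) \<in> ?L} \<and> e ` {y. (y, \<alpha>) \<in> ?L} \<subseteq> Field m" if "\<alpha> \<in> Field ?L" for \<alpha>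
    by (rule cardSuc_initial_inj[OF mcinf that])
  then obtain e where e: "\<And>\<alpha>. \<alpha> \<in> Field ?L \<Longrightarrow> inj_on (e \<alpha>) {y. (y, \<alpha>) \<in> ?L} \<and> e \<alpha> ` {y. (y, \<alpha>) \<in> ?L} \<subseteq> Field m"
    by metis
  define a where "a \<alpha> i = {\<beta>. lt ?L \<beta> \<alpha> \<and> e \<alpha> \<beta> \<in> U i}" for \<alpha> i
  have asmall: "|a \<alpha> i| <o R i" if al: "\<alpha> \<in> Field ?L" for \<alpha> i
  proof -
    have "inj_on (e \<alpha>) (a \<alpha> i)"
      by (rule inj_on_subset[OF conjunct1[OF e[OF al]]]) (auto simp: a_def lt_def)
    then have "|a \<alpha> i| \<le>o |U i|" by (rule card_of_ordLeqI) (simp add: a_def)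
    then show ?thesis unfolding R_def by (rule ordLeq_ordLess_trans[OF _ cardSuc_greater[OF card_of_Card_order]])
  qed
  have amono: "a \<alpha> i \<subseteq> a \<alpha> j" if "(i, j) \<in> k" for \<alpha> i j
    using Umono[OF that] unfolding a_def by blast
  have aun: "\<exists>i\<in>Field k. \<beta> \<in> a \<alpha> i" if l: "lt ?L \<beta> \<alpha>" for \<alpha> \<beta>
  proof -
    have "e \<alpha> \<beta> \<in> Field m" using e[OF lt_Field(2)[OF l]] lt_imp_le[OF l] by blast
    then show ?thesis using Uall l unfolding a_def by blast
  qed
  obtain f where fF: "\<And>\<alpha> i. \<alpha> \<in> Field ?L \<Longrightarrow> i \<in> Field k \<Longrightarrow> f \<alpha> i \<in> Field (R i)"
    and free: "\<And>A. A \<subseteq> Field ?L \<Longrightarrow> ?L \<le>o |A| \<Longrightarrow> \<exists>B i0. B \<subseteq> A \<and> i0 \<in> Field k \<and> ?k1 \<le>o |B| \<and>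
       (\<forall>\<alpha>\<in>B. \<forall>\<beta>\<in>B. \<alpha> \<noteq> \<beta> \<longrightarrow> (\<forall>i. (i0, i) \<in> k \<longrightarrow> f \<alpha> i \<noteq> f \<beta> i))"
    by (rule free_family[OF k(1) t lt3 L ordLess_transitive[OF m3 mL] R asmall amono aun]) (assumption+, rule that)

  define g where "g i \<eta> = (SOME g. inj_on g {y. (y, \<eta>) \<in> R i} \<and> g ` {y. (y, \<eta>) \<in> R i} \<subseteq> U i)" for i \<eta>
  have exg: "\<exists>g. inj_on g {y. (y, \<eta>) \<in> R i} \<and> g ` {y. (y, \<eta>) \<in> R i} \<subseteq> U i" if "\<eta> \<in> Field (R i)" for i \<eta>
    using cardSuc_initial_inj[OF Uinf that[unfolded R_def]] unfolding R_def by (simp add: Field_card_of)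
  have g: "inj_on (g i \<eta>) {y. (y, \<eta>) \<in> R i} \<and> g i \<eta> ` {y. (y, \<eta>) \<in> R i} \<subseteq> U i" if "\<eta> \<in> Field (R i)" for i \<eta>
    unfolding g_def by (rule someI_ex[OF exg[OF that]])
  define M where "M i = (SOME M :: 'a set \<Rightarrow> 'a set. (\<forall>\<xi>. |M \<xi>| <o k) \<and>
      (\<forall>x. x \<subseteq> U i \<longrightarrow> |x| <o k \<longrightarrow> (\<exists>\<xi>\<in>Field (R i). x \<subseteq> M \<xi>)))" for i
  have exM: "\<exists>M :: 'a set \<Rightarrow> 'a set. (\<forall>\<xi>. |M \<xi>| <o k) \<and>
      (\<forall>x. x \<subseteq> U i \<longrightarrow> |x| <o k \<longrightarrow> (\<exists>\<xi>\<in>Field (R i). x \<subseteq> M \<xi>))" if "i \<in> Field k" for i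
    unfolding R_def
    by (rule small[OF UF ordLeq_transitive[OF ordLess_imp_ordLeq[OF kt] Ut] Um[OF that]])
  have M: "(\<forall>\<xi>. |M i \<xi>| <o k) \<and>
      (\<forall>x. x \<subseteq> U i \<longrightarrow> |x| <o k \<longrightarrow> (\<exists>\<xi>\<in>Field (R i). x \<subseteq> M i \<xi>))" if "i \<in> Field k" for i
    unfolding M_def by (rule someI_ex[OF exM[OF that]])
  have "\<exists>Y. covers k (D j) Y \<and> |Y| \<le>o m" if "j \<in> Field k" for j
    using cov[OF dF[OF that]] unfolding coverable_def D_def .
  then obtain \<Y> where Y: "\<And>j. j \<in> Field k \<Longrightarrow> covers k (D j) (\<Y> j) \<and> |\<Y> j| \<le>o m" by metis
  have Yk: "|Y| \<le>o k" if "j \<in> Field k" "Y \<in> \<Y> j" for j Y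
    using Y[OF that(1)] that(2) unfolding covers_def by blast
  \<comment> \<open>The function \<open>F\<close> read off from the set to be covered must not occur
    in the family. Given \<alpha> and a set \<open>Y\<close> of at most \<open>k\<close> codes,
    there remain at most \<open>k\<close> candidates for each \<open>F i\<close>, and
    \<open>Z \<alpha> Y\<close> unites the sets belonging to all of them.\<close>
  define I where "I \<alpha> Y i = {\<xi>. (\<xi>, f \<alpha> i) \<in> R i \<and> g i (f \<alpha> i) \<xi> \<in> Y}" for \<alpha> Y i
  define Z where "Z \<alpha> Y = (\<Union>i\<in>Field k. \<Union>\<xi>\<in>I \<alpha> Y i. M i \<xi>) \<inter> Field m" for \<alpha> Y
  have inj_small: "|S| \<le>o |Y|" if "\<eta> \<in> Field (R i)" "S \<subseteq> {y. (y, \<eta>) \<in> R i}" "g i \<eta> ` S \<subseteq> Y" for S Y i \<eta>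
    by (rule card_of_ordLeqI[of "g i \<eta>"]) (use inj_on_subset[OF conjunct1[OF g[OF that(1)]] that(2)] that(3) in auto)
  have Zk: "|Z \<alpha> Y| \<le>o k" if al: "\<alpha> \<in> Field ?L" and Yk: "|Y| \<le>o k" for \<alpha> Y
  proof -
    have "|\<Union>i\<in>Field k. \<Union>\<xi>\<in>I \<alpha> Y i. M i \<xi>| \<le>o k"
    proof (rule UNION_ordLeq[OF kcinf card_of_ordLeq_Field[OF kco subset_refl]], rule UNION_ordLeq[OF kcinf])
      fix i assume i: "i \<in> Field k"
      show "|I \<alpha> Y i| \<le>o k"
        by (rule ordLeq_transitive[OF inj_small[OF fF[OF al i]] Yk]) (auto simp: I_def)
      show "|M i \<xi>| \<le>o k" for \<xi> using M[OF i] ordLess_imp_ordLeq by blast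
    qed
    then show ?thesis unfolding Z_def by (rule ordLeq_transitive[OF card_of_mono1[OF Int_lower1]])
  qed
  define \<X> where "\<X> = (\<Union>\<alpha>\<in>Field ?L. \<Union>j\<in>Field k. Z \<alpha> ` \<Y> j)"
  have Lcinf: "Cinfinite ?L" using L by blast
  have mL': "m \<le>o ?L" by (rule ordLess_imp_ordLeq[OF mL])
  have kL: "|Field k| \<le>o ?L"
    by (rule ordLeq_transitive[OF card_of_ordLeq_Field[OF kco subset_refl] ordLeq_transitive[OF ordLess_imp_ordLeq[OF m(2)] mL']])
  have XL: "|\<X>| \<le>o ?L"
    unfolding \<X>_def
  proof (rule UNION_ordLeq[OF Lcinf card_of_ordLeq_Field[OF Lco subset_refl]], rule UNION_ordLeq[OF Lcinf kL])
    fix \<alpha> j assume "j \<in> Field k"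
    then have "|\<Y> j| \<le>o m" using Y by blast
    then show "|Z \<alpha> ` \<Y> j| \<le>o ?L" by (rule ordLeq_transitive[OF card_of_image ordLeq_transitive[OF _ mL']])
  qed
  have main: "\<exists>z\<in>\<X>. A \<subseteq> z" if A: "A \<subseteq> Field m" "|A| \<le>o k" "A \<noteq> {}" for A
  proof -
    have "|A| \<le>o |Field k|" by (rule ordLeq_ordIso_trans[OF A(2) ordIso_symmetric[OF card_of_Field_ordIso[OF kco]]])
    from iffD2[OF card_of_ordLeq2[OF A(3)] this] obtain x where x: "x ` Field k = A" by blast
    have "\<exists>\<xi>. \<xi> \<in> Field (R i) \<and> x ` {j. lt k j i} \<inter> U i \<subseteq> M i \<xi>" if i: "i \<in> Field k" for i
    proof -
      have "|x ` {j. lt k j i} \<inter> U i| <o k"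
        by (rule ordLeq_ordLess_trans[OF card_of_mono1[OF Int_lower1]
              ordLeq_ordLess_trans[OF card_of_image initial_small[OF kco i]]])
      from conjunct2[OF M[OF i], rule_format, OF Int_lower2 this] show ?thesis by blast
    qed
    then obtain F where F: "\<And>i. i \<in> Field k \<Longrightarrow> F i \<in> Field (R i) \<and> x ` {j. lt k j i} \<inter> U i \<subseteq> M i (F i)" by metis
    have RF: "Well_order (R i)" for i using R[of i] Card_order_wo by blast
    \<comment> \<open>Whichever of \<open>F i\<close> and \<open>f \<alpha> i\<close> is smaller
      gets its code relative to the other one.\<close>
    define lo where "lo \<alpha> Y = {i \<in> Field k. (F i, f \<alpha> i) \<in> R i \<and> g i (f \<alpha> i) (F i) \<in> Y}" for \<alpha> Y
    define hi where "hi \<alpha> Y = {i \<in> Field k. (f \<alpha> i, F i) \<in> R i \<and> g i (F i) (f \<alpha> i) \<in> Y}" for \<alpha> Y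
    \<comment> \<open>The code at \<open>i\<close> lies in some \<open>D j\<close> with
      \<open>j\<close> below \<open>i\<close>. Pressing down fixes \<open>j\<close> for unboundedly
      many \<open>i\<close>, and the covering family of \<open>D j\<close> then replaces
      \<open>D j\<close> by a set of size at most \<open>k\<close>.\<close>
    have dich: "\<exists>j\<in>Field k. \<exists>y\<in>\<Y> j. unb k (lo \<alpha> y) \<or> unb k (hi \<alpha> y)" if al: "\<alpha> \<in> Field ?L" for \<alpha>
    proof -
      have "\<exists>j\<in>Field k. unb k {i \<in> Field k. i \<in> lo \<alpha> (D j) \<union> hi \<alpha> (D j)}"
      proof (rule regressive_unbounded[OF k])
        fix i assume i: "i \<in> Field k" and "\<exists>z. lt k z i"
        then obtain z where z: "lt k z i" by blast
        have FR: "F i \<in> Field (R i)" and fR: "f \<alpha> i \<in> Field (R i)" using F[OF i] fF[OF al i] by blast+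
        show "\<exists>j. lt k j i \<and> i \<in> lo \<alpha> (D j) \<union> hi \<alpha> (D j)"
        proof (cases "(F i, f \<alpha> i) \<in> R i")
          case True
          then have "g i (f \<alpha> i) (F i) \<in> U i" using g[OF fR] by blast
          then show ?thesis using Ureg[OF _ z] True i unfolding lo_def by blast
        next
          case False
          then have l: "(f \<alpha> i, F i) \<in> R i" using not_le[OF RF FR fR] lt_imp_le by fast
          then have "g i (F i) (f \<alpha> i) \<in> U i" using g[OF FR] by blast
          then show ?thesis using Ureg[OF _ z] l i unfolding hi_def by blast
        qed
      qed
      then obtain j where j: "j \<in> Field k" "unb k {i \<in> Field k. i \<in> lo \<alpha> (D j) \<union> hi \<alpha> (D j)}" by blast
      have "{i \<in> Field k. i \<in> lo \<alpha> (D j) \<union> hi \<alpha> (D j)} = lo \<alpha> (D j) \<union> hi \<alpha> (D j)"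
        unfolding lo_def hi_def by blast
      then have "unb k (lo \<alpha> (D j)) \<or> unb k (hi \<alpha> (D j))" using unb_Un[OF kwo] j(2) by simp
      then show ?thesis
      proof
        assume u: "unb k (lo \<alpha> (D j))"
        obtain y where y: "y \<in> \<Y> j" "unb k {i \<in> lo \<alpha> (D j). g i (f \<alpha> i) (F i) \<in> y}"
          using unb_covers[OF k(1) u, of "\<lambda>i. g i (f \<alpha> i) (F i)" "D j" "\<Y> j"] Y[OF j(1)] by (auto simp: lo_def)
        have "{i \<in> lo \<alpha> (D j). g i (f \<alpha> i) (F i) \<in> y} \<subseteq> lo \<alpha> y" unfolding lo_def by blast
        then have "unb k (lo \<alpha> y)" using y(2) unfolding unb_def lo_def by blast
        then show ?thesis using j(1) y(1) by blast
      next
        assume u: "unb k (hi \<alpha> (D j))"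
        obtain y where y: "y \<in> \<Y> j" "unb k {i \<in> hi \<alpha> (D j). g i (F i) (f \<alpha> i) \<in> y}"
          using unb_covers[OF k(1) u, of "\<lambda>i. g i (F i) (f \<alpha> i)" "D j" "\<Y> j"] Y[OF j(1)] by (auto simp: hi_def)
        have "{i \<in> hi \<alpha> (D j). g i (F i) (f \<alpha> i) \<in> y} \<subseteq> hi \<alpha> y" unfolding hi_def by blast
        then have "unb k (hi \<alpha> y)" using y(2) unfolding unb_def hi_def by blast
        then show ?thesis using j(1) y(1) by blast
      qed
    qed
    show ?thesis
    proof (cases "\<exists>\<alpha>\<in>Field ?L. \<exists>j\<in>Field k. \<exists>y\<in>\<Y> j. unb k (lo \<alpha> y)")
      case True
      then obtain \<alpha> j y where al: "\<alpha> \<in> Field ?L" "j \<in> Field k" "y \<in> \<Y> j" "unb k (lo \<alpha> y)" by blast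
      have "A \<subseteq> Z \<alpha> y"
      proof
        fix u assume uA: "u \<in> A"
        then have um: "u \<in> Field m" using A(1) by blast
        obtain j' where j': "j' \<in> Field k" "u = x j'" using x uA by blast
        obtain i' where i': "i' \<in> Field k" "u \<in> U i'" using Uall[OF um] by blast
        obtain n where n: "(j', n) \<in> k" "(i', n) \<in> k" using max_ex[OF kwo j'(1) i'(1)] .
        obtain i where i: "i \<in> lo \<alpha> y" "lt k n i" using al(4) kF[OF n(1)] unfolding unb_def by blast
        have iF: "i \<in> Field k" using lt_Field(2)[OF i(2)] .
        have "lt k j' i" "lt k i' i" using le_lt_trans[OF kwo _ i(2)] n by blast+
        then have "u \<in> x ` {j. lt k j i} \<inter> U i" using j'(2) i'(2) Umono[OF lt_imp_le, of i' i] by blast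
        then have uM: "u \<in> M i (F i)" using F[OF iF] by blast
        have "F i \<in> I \<alpha> y i" using i(1) unfolding lo_def I_def by blast
        then show "u \<in> Z \<alpha> y" unfolding Z_def using uM um iF by blast
      qed
      moreover have "Z \<alpha> y \<in> \<X>" unfolding \<X>_def using al by blast
      ultimately show ?thesis by blast
    next
      case False
      \<comment> \<open>Now \<open>F\<close> is at or above every \<open>f \<alpha>\<close> at
        unboundedly many places. As there are only \<open>m\<close> pairs \<open>(j, y)\<close>, one
        of them serves \<open>?L\<close> many \<alpha>. A free part of size \<open>?k1\<close> has
        distinct values at a common \<open>i\<close>, all coded in \<open>y\<close> relative to
        \<open>F i\<close>, which contradicts \<open>|y| \<le>o k\<close>.\<close>
      then have "\<exists>p. p \<in> Sigma (Field k) \<Y> \<and> unb k (hi \<alpha> (snd p))" if "\<alpha> \<in> Field ?L" for \<alpha>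
        using dich[OF that] that by fastforce
      then obtain p where p: "\<And>\<alpha>. \<alpha> \<in> Field ?L \<Longrightarrow> p \<alpha> \<in> Sigma (Field k) \<Y> \<and> unb k (hi \<alpha> (snd (p \<alpha>)))" by metis
      have "|Sigma (Field k) \<Y>| \<le>o m"
      proof (rule card_of_Sigma_ordLeq_infinite_Field[OF _ m(1)])
        show "infinite (Field m)" using mcinf by (simp add: cinfinite_def)
        show "|Field k| \<le>o m"
          by (rule ordLeq_transitive[OF card_of_ordLeq_Field[OF kco subset_refl] ordLess_imp_ordLeq[OF m(2)]])
        show "\<forall>j\<in>Field k. |\<Y> j| \<le>o m" using Y by blast
      qed
      then have SL: "|Sigma (Field k) \<Y>| <o ?L" by (rule ordLeq_ordLess_trans[OF _ mL])
      have "?L \<le>o |Field ?L|"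
        by (rule ordIso_imp_ordLeq[OF ordIso_symmetric[OF card_of_Field_ordIso[OF Lco]]])
      from pigeonhole_stable[OF Lco Reg_stable[OF L] SL _ this, of p] p
      obtain q where q: "q \<in> Sigma (Field k) \<Y>" "?L \<le>o |{\<alpha> \<in> Field ?L. p \<alpha> = q}|" by blast
      obtain j y where qy: "q = (j, y)" by (cases q)
      have jy: "j \<in> Field k" "y \<in> \<Y> j" using q(1) qy by auto
      have "{\<alpha> \<in> Field ?L. p \<alpha> = q} \<subseteq> Field ?L" by blast
      from free[OF this q(2)] obtain B i0 where "B \<subseteq> {\<alpha> \<in> Field ?L. p \<alpha> = q} \<and> i0 \<in> Field k \<and> ?k1 \<le>o |B| \<and>
        (\<forall>\<alpha>\<in>B. \<forall>\<beta>\<in>B. \<alpha> \<noteq> \<beta> \<longrightarrow> (\<forall>i. (i0, i) \<in> k \<longrightarrow> f \<alpha> i \<noteq> f \<beta> i))" by (elim exE)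
      then have B: "B \<subseteq> {\<alpha> \<in> Field ?L. p \<alpha> = q}" "i0 \<in> Field k" "?k1 \<le>o |B|"
        "\<And>\<alpha> \<beta> i. \<alpha> \<in> B \<Longrightarrow> \<beta> \<in> B \<Longrightarrow> \<alpha> \<noteq> \<beta> \<Longrightarrow> (i0, i) \<in> k \<Longrightarrow> f \<alpha> i \<noteq> f \<beta> i"
        by simp_all
      have "\<exists>i. i \<in> hi \<alpha> y \<and> lt k i0 i" if al: "\<alpha> \<in> B" for \<alpha>
      proof -
        have "\<alpha> \<in> Field ?L" "p \<alpha> = (j, y)" using B(1) al qy by auto
        then have "unb k (hi \<alpha> y)" using p[of \<alpha>] by simp
        then show ?thesis using B(2) unfolding unb_def by blast
      qed
      then obtain ii where ii: "\<And>\<alpha>. \<alpha> \<in> B \<Longrightarrow> ii \<alpha> \<in> hi \<alpha> y \<and> lt k i0 (ii \<alpha>)" by metis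
      have "|Field k| <o ?k1" by (rule ordLeq_ordLess_trans[OF card_of_ordLeq_Field[OF kco subset_refl] lt1])
      from pigeonhole_stable[OF k1co Reg_stable[OF k1] this _ B(3), of ii] ii
      obtain i where i: "i \<in> Field k" "?k1 \<le>o |{\<alpha> \<in> B. ii \<alpha> = i}|" unfolding hi_def by blast
      let ?B = "{\<alpha> \<in> B. ii \<alpha> = i}"
      have Bi: "(i0, i) \<in> k" "(f \<alpha> i, F i) \<in> R i" "g i (F i) (f \<alpha> i) \<in> y" if "\<alpha> \<in> ?B" for \<alpha>
        using ii[of \<alpha>] that lt_imp_le unfolding hi_def by fast+
      have FR: "F i \<in> Field (R i)" using F[OF i(1)] by blast
      have "inj_on (\<lambda>\<alpha>. f \<alpha> i) ?B"
        by (rule inj_onI, rule ccontr) (use B(4) Bi(1) in blast)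
      then have 1: "|?B| \<le>o |(\<lambda>\<alpha>. f \<alpha> i) ` ?B|" by (rule card_of_ordLeqI) blast
      have 2: "|(\<lambda>\<alpha>. f \<alpha> i) ` ?B| \<le>o |y|" by (rule inj_small[OF FR]) (use Bi in auto)
      have "?k1 \<le>o k"
        by (rule ordLeq_transitive[OF i(2) ordLeq_transitive[OF 1 ordLeq_transitive[OF 2 Yk[OF jy]]]])
      then show ?thesis using not_ordLess_ordLeq[OF lt1] by blast
    qed
  qed
  have "covers k (Field m) \<X>"
    unfolding covers_def
  proof (intro conjI ballI allI impI)
    fix z assume "z \<in> \<X>"
    then obtain \<alpha> j y where z: "\<alpha> \<in> Field ?L" "j \<in> Field k" "y \<in> \<Y> j" "z = Z \<alpha> y" unfolding \<X>_def by blast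
    show "z \<subseteq> Field m" unfolding z(4) Z_def by blast
    show "|z| \<le>o k" unfolding z(4) by (rule Zk[OF z(1) Yk[OF z(2,3)]])
  next
    fix A assume A: "A \<subseteq> Field m" "|A| \<le>o k"
    show "\<exists>Q\<subseteq>\<X>. |Q| <o k \<and> A \<subseteq> \<Union>Q"
    proof (cases "A = {}")
      case True
      have "|{} :: 'a set set| <o k" by (rule finite_ordLess[OF k(2)]) simp
      then show ?thesis using True by blast
    next
      case False
      \<comment> \<open>At cofinality \<open>k\<close> one member covers the whole set; several are
        needed only for cofinalities below \<open>k\<close>.\<close>
      then obtain z where z: "z \<in> \<X>" "A \<subseteq> z" using main[OF A] by blast
      have "|{z}| <o k" by (rule finite_ordLess[OF k(2)]) simp
      then show ?thesis using z by (intro exI[of _ "{z}"]) simp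
    qed
  qed
  then show ?thesis unfolding coverable_def using XL by blast
qed

section \<open>Covering numbers\<close>

text \<open>Since \<open>|V|\<close> may be singular, \<open>V\<close> is embedded into its regular
  successor. This is the origin of the index set \<open>cardSuc |V|\<close> and of the condition
  that this successor be at most \<open>l\<close>.\<close>

lemma mildly_ineffable_covering_set:
  fixes k :: "'b rel" and l :: "'a rel" and V :: "'c set"
  assumes mild: "mildly_ineffable k l" and l: "Card_order l" and k: "Reg k" "natLeq <o k"
    and V: "k \<le>o |V|" "cardSuc |V| \<le>o l"
  shows "\<exists>M :: 'c set \<Rightarrow> 'c set. (\<forall>\<xi>. |M \<xi>| <o k) \<and>
    (\<forall>x. x \<subseteq> V \<longrightarrow> |x| <o k \<longrightarrow> (\<exists>\<xi>\<in>Field (cardSuc |V| ). x \<subseteq> M \<xi>))"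
proof -
  let ?r = "cardSuc |V|"
  have kcinf: "Cinfinite k" using k by blast
  have Vinf: "Cinfinite |V|" using cinfinite_mono[OF V(1)] kcinf card_of_Card_order by blast
  have r: "Reg ?r" by (rule Reg_cardSuc[OF Vinf])
  then have rco: "Card_order ?r" by blast
  have Vr: "|V| <o ?r" by (rule cardSuc_greater[OF card_of_Card_order])
  obtain M :: "'c set \<Rightarrow> 'c set set" where M: "\<And>\<alpha>. |M \<alpha>| <o k"
    "\<And>x. x \<subseteq> Field ?r \<Longrightarrow> |x| <o k \<Longrightarrow> \<exists>\<alpha>\<in>Field ?r. x \<subseteq> M \<alpha>"
    by (rule mildly_ineffable_covering[OF mild l k r ordLeq_ordLess_trans[OF V(1) Vr] V(2)]) (rule that)
  have "|V| \<le>o |Field ?r|"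
    by (rule ordLeq_ordIso_trans[OF ordLess_imp_ordLeq[OF Vr] ordIso_symmetric[OF card_of_Field_ordIso[OF rco]]])
  from iffD2[OF card_of_ordLeq this] obtain h where h: "inj_on h V" "h ` V \<subseteq> Field ?r" by blast
  define M' where "M' \<xi> = {v \<in> V. h v \<in> M \<xi>}" for \<xi>
  show ?thesis
  proof (intro exI[of _ M'] conjI allI impI)
    fix \<xi>
    have "|M' \<xi>| \<le>o |M \<xi>|"
      by (rule card_of_ordLeqI[of h]) (use h(1) in \<open>auto simp: M'_def inj_on_def\<close>)
    then show "|M' \<xi>| <o k" by (rule ordLeq_ordLess_trans[OF _ M(1)])
  next
    fix x assume x: "x \<subseteq> V" "|x| <o k"
    have "h ` x \<subseteq> Field ?r" using x(1) h(2) by blast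
    from M(2)[OF this ordLeq_ordLess_trans[OF card_of_image x(2)]]
    obtain \<alpha> where "\<alpha> \<in> Field ?r" "h ` x \<subseteq> M \<alpha>" by blast
    then show "\<exists>\<xi>\<in>Field ?r. x \<subseteq> M' \<xi>" using x(1) unfolding M'_def by blast
  qed
qed

section \<open>Covering when the cofinality differs from \<open>k\<close>\<close>

lemma coverable_mono: "coverable k A r \<Longrightarrow> r \<le>o r' \<Longrightarrow> coverable k A r'"
  unfolding coverable_def using ordLeq_transitive[of _ r r'] by blast

lemma coverable_ordLeq:
  assumes "natLeq <o k" "|A| \<le>o k" "Cinfinite r"
  shows "coverable k A r"
proof -
  have k: "|{A}| <o k" by (rule finite_ordLess[OF assms(1)]) simp
  have "|{A}| \<le>o |Field r|"
    by (rule card_of_singl_ordLeq) (use assms(3) in \<open>auto simp: cinfinite_def\<close>)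
  then have r: "|{A}| \<le>o r"
    by (rule ordLeq_ordIso_trans[OF _ card_of_Field_ordIso]) (use assms(3) in blast)
  have "\<exists>Q\<subseteq>{A}. |Q| <o k \<and> a \<subseteq> \<Union>Q" if "a \<subseteq> A" for a
    by (rule exI[of _ "{A}"]) (use k that in simp)
  then have "covers k A {A}" unfolding covers_def using assms(2) by simp
  then show ?thesis unfolding coverable_def using r by blast
qed

text \<open>The alternatives in \<open>K\<close> are cofinality below \<open>k\<close> and above
  \<open>k\<close>. In the first case a set splits into fewer than \<open>k\<close> bounded pieces,
  each covered by fewer than \<open>k\<close> sets, and regularity of \<open>k\<close> counts them;
  in the second a set of size \<open>k\<close> is itself bounded.\<close>

lemma coverable_Field:
  fixes k :: "'b rel" and m :: "'a rel"
  assumes k: "Reg k" and m: "Cinfinite m"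
    and cov: "\<And>u. u \<in> Field m \<Longrightarrow> coverable k {x. (x, u) \<in> m} m"
    and K: "(\<exists>K\<subseteq>Field m. |K| <o k \<and> (\<forall>u\<in>Field m. \<exists>x\<in>K. (u, x) \<in> m)) \<or>
      (\<forall>X\<subseteq>Field m. |X| \<le>o k \<longrightarrow> (\<exists>b\<in>Field m. \<forall>x\<in>X. lt m x b))"
  shows "coverable k (Field m) m"
proof -
  have mco: "Card_order m" using m by blast
  have "\<exists>Y. covers k {x. (x, u) \<in> m} Y \<and> |Y| \<le>o m" if "u \<in> Field m" for u
    using cov[OF that] unfolding coverable_def .
  then obtain \<Y> where Y: "\<And>u. u \<in> Field m \<Longrightarrow> covers k {x. (x, u) \<in> m} (\<Y> u) \<and> |\<Y> u| \<le>o m" by metis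
  let ?X = "\<Union>u\<in>Field m. \<Y> u"
  have Xm: "|?X| \<le>o m"
    by (rule UNION_ordLeq[OF m card_of_ordLeq_Field[OF mco subset_refl]]) (use Y in blast)
  have ex: "\<exists>Q\<subseteq>?X. |Q| <o k \<and> a \<inter> {x. (x, u) \<in> m} \<subseteq> \<Union>Q" if u: "u \<in> Field m" and a: "|a| \<le>o k" for u a
  proof -
    have "|a \<inter> {x. (x, u) \<in> m}| \<le>o k" by (rule ordLeq_transitive[OF card_of_mono1[OF Int_lower1] a])
    from conjunct2[OF conjunct1[OF Y[OF u], unfolded covers_def], rule_format, OF Int_lower2 this]
    obtain Q where "Q \<subseteq> \<Y> u" "|Q| <o k" "a \<inter> {x. (x, u) \<in> m} \<subseteq> \<Union>Q" by (elim exE conjE)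
    then show ?thesis using u by (intro exI[of _ Q]) auto
  qed
  have "\<exists>Q\<subseteq>?X. |Q| <o k \<and> a \<subseteq> \<Union>Q" if a: "a \<subseteq> Field m" "|a| \<le>o k" for a
    using K
  proof
    assume "\<exists>K\<subseteq>Field m. |K| <o k \<and> (\<forall>u\<in>Field m. \<exists>x\<in>K. (u, x) \<in> m)"
    then obtain K where K: "K \<subseteq> Field m" "|K| <o k" "\<And>u. u \<in> Field m \<Longrightarrow> \<exists>x\<in>K. (u, x) \<in> m" by blast
    have "\<forall>u\<in>K. \<exists>Q. Q \<subseteq> ?X \<and> |Q| <o k \<and> a \<inter> {x. (x, u) \<in> m} \<subseteq> \<Union>Q" using ex[OF _ a(2)] K(1) by blast
    from bchoice[OF this] obtain Q where Q: "\<And>u. u \<in> K \<Longrightarrow> Q u \<subseteq> ?X \<and> |Q u| <o k \<and> a \<inter> {x. (x, u) \<in> m} \<subseteq> \<Union>(Q u)"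
      by blast
    have "|\<Union>u\<in>K. Q u| <o k" by (rule stable_UNION[OF Reg_stable[OF k] K(2)]) (use Q in blast)
    moreover have "(\<Union>u\<in>K. Q u) \<subseteq> ?X" using Q by blast
    moreover have "a \<subseteq> \<Union>(\<Union>u\<in>K. Q u)"
    proof
      fix x assume x: "x \<in> a"
      obtain u where u: "u \<in> K" "(x, u) \<in> m" using K(3)[of x] x a(1) by blast
      then have "x \<in> \<Union>(Q u)" using Q[OF u(1)] x by blast
      then show "x \<in> \<Union>(\<Union>u\<in>K. Q u)" using u(1) by blast
    qed
    ultimately show ?thesis by (intro exI[of _ "\<Union>u\<in>K. Q u"] conjI)
  next
    assume "\<forall>X\<subseteq>Field m. |X| \<le>o k \<longrightarrow> (\<exists>b\<in>Field m. \<forall>x\<in>X. lt m x b)"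
    then obtain b where b: "b \<in> Field m" "\<forall>x\<in>a. lt m x b" using a by blast
    then have "a \<inter> {x. (x, b) \<in> m} = a" using lt_imp_le by fast
    then show ?thesis using ex[OF b(1) a(2)] by simp
  qed
  moreover have "\<forall>x\<in>?X. x \<subseteq> Field m \<and> |x| \<le>o k"
  proof
    fix x assume "x \<in> ?X"
    then obtain u where u: "u \<in> Field m" "x \<in> \<Y> u" by blast
    have "{x. (x, u) \<in> m} \<subseteq> Field m" by (auto simp: Field_def)
    then show "x \<subseteq> Field m \<and> |x| \<le>o k" using Y[OF u(1)] u(2) unfolding covers_def by blast
  qed
  ultimately have "covers k (Field m) ?X" unfolding covers_def by simp
  then show ?thesis unfolding coverable_def using Xm by blast
qed

lemma cofinality_cases:
  fixes k :: "'b rel" and m :: "'a rel"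
  assumes k: "Card_order k" and m: "Cinfinite m"
  obtains (regular_like) "(\<exists>K\<subseteq>Field m. |K| <o k \<and> (\<forall>u\<in>Field m. \<exists>x\<in>K. (u, x) \<in> m)) \<or>
      (\<forall>X\<subseteq>Field m. |X| \<le>o k \<longrightarrow> (\<exists>b\<in>Field m. \<forall>x\<in>X. lt m x b))"
  | (cofinal_k) X where "X \<subseteq> Field m" "|X| \<le>o k" "\<And>u. u \<in> Field m \<Longrightarrow> \<exists>x\<in>X. (u, x) \<in> m"
      "\<And>X. X \<subseteq> Field m \<Longrightarrow> |X| <o k \<Longrightarrow> \<exists>b\<in>Field m. \<forall>x\<in>X. lt m x b"
proof -
  have wo: "Well_order m" using m Card_order_wo by blast
  show ?thesis
  proof (cases "(\<exists>K\<subseteq>Field m. |K| <o k \<and> (\<forall>u\<in>Field m. \<exists>x\<in>K. (u, x) \<in> m)) \<or>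
      (\<forall>X\<subseteq>Field m. |X| \<le>o k \<longrightarrow> (\<exists>b\<in>Field m. \<forall>x\<in>X. lt m x b))")
    case True
    then show ?thesis by (rule regular_like)
  next
    case False
    then obtain X where X: "X \<subseteq> Field m" "|X| \<le>o k" "\<not> (\<exists>b\<in>Field m. \<forall>x\<in>X. lt m x b)" by blast
    show ?thesis
    proof (rule cofinal_k[OF X(1,2)])
      fix u assume u: "u \<in> Field m"
      then obtain x where "x \<in> X" "\<not> lt m x u" using X(3) by blast
      then show "\<exists>x\<in>X. (u, x) \<in> m" using not_lt[OF wo _ u] X(1) by blast
    next
      fix Y assume Y: "Y \<subseteq> Field m" "|Y| <o k"
      have "\<not> (\<exists>K\<subseteq>Field m. |K| <o k \<and> (\<forall>u\<in>Field m. \<exists>x\<in>K. (u, x) \<in> m))"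
        using False by (simp only: de_Morgan_disj simp_thms)
      then have "\<not> (\<forall>u\<in>Field m. \<exists>x\<in>Y. (u, x) \<in> m)" using Y by (auto 0 0)
      then obtain u where u: "u \<in> Field m" "\<And>x. x \<in> Y \<Longrightarrow> (u, x) \<notin> m" by blast
      have "lt m x u" if "x \<in> Y" for x using not_le[OF wo u(1) _ u(2)[OF that]] Y(1) that by blast
      then show "\<exists>b\<in>Field m. \<forall>x\<in>Y. lt m x b" using u(1) by blast
    qed
  qed
qed

lemma cofinality_eq:
  fixes k :: "'b rel" and m :: "'a rel"
  assumes k: "Card_order k" and m: "Cinfinite m"
    and X: "X \<subseteq> Field m" "|X| \<le>o k" "\<And>u. u \<in> Field m \<Longrightarrow> \<exists>x\<in>X. (u, x) \<in> m"
    and bdd: "\<And>X. X \<subseteq> Field m \<Longrightarrow> |X| <o k \<Longrightarrow> \<exists>b\<in>Field m. \<forall>x\<in>X. lt m x b"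
  shows "cofinality m =o k"
proof -
  have wo: "Well_order m" using m Card_order_wo by blast
  let ?F = "{A. A \<subseteq> Field m \<and> cofinal A m}"
  have XF: "X \<in> ?F"
  proof -
    have "\<exists>b\<in>X. u \<noteq> b \<and> (u, b) \<in> m" if u: "u \<in> Field m" for u
    proof -
      \<comment> \<open>Since \<open>cofinal\<close> asks for strictly larger elements,
        \<open>X\<close> is entered above some \<open>v\<close> larger than
        \<open>u\<close>.\<close>
      obtain v where v: "lt m u v" using succ_ex[OF m u] .
      obtain x where x: "x \<in> X" "(v, x) \<in> m" using X(3)[OF lt_Field(2)[OF v]] by blast
      then show ?thesis using lt_le_trans[OF wo v x(2)] by (auto simp: lt_def)
    qed
    then show ?thesis using X(1) by (simp add: cofinal_def)
  qed
  then have ne: "?F \<noteq> {}" by blast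
  have le: "cofinality m \<le>o k"
    unfolding cofinality_def by (rule ordLeq_transitive[OF bspec[OF least_card(2)[OF ne] XF] X(2)])
  obtain A where A: "A \<subseteq> Field m" "cofinal A m" "cofinality m = |A|"
    using least_card(1)[OF ne] unfolding cofinality_def by blast
  have "\<not> |A| <o k"
  proof
    assume "|A| <o k"
    from bdd[OF A(1) this] obtain b where b: "b \<in> Field m" "\<forall>x\<in>A. lt m x b" by blast
    obtain x where x: "x \<in> A" "(b, x) \<in> m" using A(2) b(1) unfolding cofinal_def by blast
    have "lt m x b" using b(2) x(1) by blast
    then show False using lt_asym[OF wo] x(2) by blast
  qed
  then have "k \<le>o |A|" by (simp add: not_ordLess[OF k])
  then show ?thesis using le unfolding A(3) by (simp add: ordIso_iff_ordLeq)
qed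

lemma coverable_cardSuc:
  fixes k :: "'b rel" and l :: "'a rel" and A :: "'a set"
  assumes mild: "mildly_ineffable k l" and l: "Card_order l" and k: "Reg k" "natLeq <o k"
    and "cardSuc |A| \<le>o l" "k \<le>o |A|"
  shows "coverable k A (cardSuc |A| )"
  using assms(5,6)
proof (induction A rule: wf_induct_rule[OF wf_inv_image[OF wf_ordLess, of card_of]])
  case (1 A)
  have kco: "Card_order k" and kcinf: "Cinfinite k" using k by blast+
  let ?m = "|A|"
  have mco: "Card_order ?m" by (rule card_of_Card_order)
  have mcinf: "Cinfinite ?m" using cinfinite_mono[OF 1(3)] kcinf mco by blast
  have s: "?m <o cardSuc ?m" by (rule cardSuc_greater[OF mco])
  have scinf: "Cinfinite (cardSuc ?m)" using Reg_cardSuc[OF mcinf] by blast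
  have small: "cardSuc |B| \<le>o ?m" if "|B| <o ?m" for B :: "'a set"
    using cardSuc_ordLess_ordLeq[OF card_of_Card_order mco] that by blast
  have ml: "?m \<le>o l" by (rule ordLeq_transitive[OF ordLess_imp_ordLeq[OF s] 1(2)])
  have cov: "coverable k {x. (x, u) \<in> ?m} ?m" if u: "u \<in> Field ?m" for u
  proof -
    let ?B = "{x. (x, u) \<in> ?m}"
    have B: "|?B| <o ?m" by (rule initial_small_le[OF mcinf u])
    show ?thesis
    proof (cases "k \<le>o |?B|")
      case True
      have "coverable k ?B (cardSuc |?B| )"
      proof (rule 1(1)[OF _ _ True])
        show "(?B, A) \<in> inv_image ordLess card_of" using B by simp
        show "cardSuc |?B| \<le>o l" by (rule ordLeq_transitive[OF small[OF B] ml])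
      qed
      then show ?thesis by (rule coverable_mono[OF _ small[OF B]])
    next
      case False
      then have "|?B| \<le>o k" using not_ordLess[OF kco] ordLess_imp_ordLeq by blast
      then show ?thesis by (rule coverable_ordLeq[OF k(2) _ mcinf])
    qed
  qed
  show ?case
  proof (cases "k <o ?m")
    case False
    then have "?m \<le>o k" using not_ordLess_iff_ordLeq[OF Card_order_wo[OF mco] Card_order_wo[OF kco]] by blast
    then show ?thesis by (rule coverable_ordLeq[OF k(2) _ scinf])
  next
    case True
    have Fm: "Field ?m = A" by (rule Field_card_of)
    show ?thesis
    proof (rule cofinality_cases[OF kco mcinf])
      assume *: "(\<exists>K\<subseteq>Field ?m. |K| <o k \<and> (\<forall>u\<in>Field ?m. \<exists>x\<in>K. (u, x) \<in> ?m)) \<or>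
        (\<forall>X\<subseteq>Field ?m. |X| \<le>o k \<longrightarrow> (\<exists>b\<in>Field ?m. \<forall>x\<in>X. lt ?m x b))"
      have "coverable k (Field ?m) ?m" by (rule coverable_Field[OF k(1) mcinf _ *]) (rule cov)
      then show ?thesis unfolding Fm by (rule coverable_mono[OF _ ordLess_imp_ordLeq[OF s]])
    next
      fix X assume X: "X \<subseteq> Field ?m" "|X| \<le>o k" "\<And>u. u \<in> Field ?m \<Longrightarrow> \<exists>x\<in>X. (u, x) \<in> ?m"
        and bdd: "\<And>X. X \<subseteq> Field ?m \<Longrightarrow> |X| <o k \<Longrightarrow> \<exists>b\<in>Field ?m. \<forall>x\<in>X. lt ?m x b"
      have "Field ?m \<noteq> {}" using mcinf by (auto simp: cinfinite_def)
      then have ne: "X \<noteq> {}" using X(3) by blast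
      have "|X| \<le>o |Field k|"
        by (rule ordLeq_ordIso_trans[OF X(2) ordIso_symmetric[OF card_of_Field_ordIso[OF kco]]])
      \<comment> \<open>Indexing \<open>X\<close> by all of \<open>Field k\<close> may repeat
        elements; the increasing pieces are formed later by unions.\<close>
      from iffD2[OF card_of_ordLeq2[OF ne] this] obtain c where c: "c ` Field k = X" by blast
      have "coverable k (Field ?m) (cardSuc ?m)"
      proof (rule coverable_singular[OF k mco True _ _ bdd cov])
        show "c i \<in> Field ?m" if "i \<in> Field k" for i using c X(1) that by blast
        show "\<exists>i\<in>Field k. (u, c i) \<in> ?m" if "u \<in> Field ?m" for u using X(3)[OF that] c by blast
        show "\<exists>M :: 'a set \<Rightarrow> 'a set. (\<forall>\<xi>. |M \<xi>| <o k) \<and>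
          (\<forall>x. x \<subseteq> V \<longrightarrow> |x| <o k \<longrightarrow> (\<exists>\<xi>\<in>Field (cardSuc |V| ). x \<subseteq> M \<xi>))"
          if "k \<le>o |V|" "|V| <o ?m" for V :: "'a set"
          by (rule mildly_ineffable_covering_set[OF mild l k that(1) ordLeq_transitive[OF small[OF that(2)] ml]])
      qed
      then show ?thesis unfolding Fm .
    qed
  qed
qed

theorem proposition7p12:
  fixes k :: "'b rel" and l :: "'a rel"
  assumes "Card_order k" and "natLeq <o k" and "regularCard k"
    and "Card_order l" and "k \<le>o l"
    and "mildly_ineffable k l"
    and "\<not> cofinality l =o k"
  shows "cov l (cardSuc k) (cardSuc k) k =o l"
proof -
  note kco = assms(1) and lco = assms(4)
  have kcinf: "Cinfinite k" by (rule ordLess_Cinfinite_mono[OF natLeq_Cinfinite assms(2,1)])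
  have k: "Reg k" using kcinf assms(3) by blast
  have lcinf: "Cinfinite l" using cinfinite_mono[OF assms(5)] kcinf lco by blast
  \<comment> \<open>If \<open>l\<close> were equal to \<open>k\<close>, it would be regular and of
    cofinality \<open>k\<close>, which is excluded.\<close>
  have kl: "k <o l"
  proof (rule ccontr)
    assume "\<not> k <o l"
    then have lk: "l \<le>o k" using not_ordLess_iff_ordLeq[OF Card_order_wo[OF lco] Card_order_wo[OF kco]] by blast
    have iso: "k =o l" using lk assms(5) by (simp add: ordIso_iff_ordLeq)
    have "Reg l" using regularCard_ordIso[OF iso kcinf assms(3)] lcinf by blast
    have "cofinality l =o k"
    proof (rule cofinality_eq[OF kco lcinf subset_refl])
      show "|Field l| \<le>o k" by (rule ordLeq_transitive[OF card_of_ordLeq_Field[OF lco subset_refl] lk])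
      show "\<exists>x\<in>Field l. (u, x) \<in> l" if "u \<in> Field l" for u using le_refl[OF Card_order_wo[OF lco] that] that by blast
      show "\<exists>b\<in>Field l. \<forall>x\<in>X. lt l x b" if "X \<subseteq> Field l" "|X| <o k" for X
        by (rule Reg_bounded[OF \<open>Reg l\<close> that(1) ordLess_ordLeq_trans[OF that(2) assms(5)]])
    qed
    then show False using assms(7) by blast
  qed
  have cov: "coverable k {x. (x, u) \<in> l} l" if u: "u \<in> Field l" for u
  proof -
    let ?B = "{x. (x, u) \<in> l}"
    have "|?B| <o l" by (rule initial_small_le[OF lcinf u])
    then have B: "cardSuc |?B| \<le>o l" using cardSuc_ordLess_ordLeq[OF card_of_Card_order lco] by blast
    show ?thesis
    proof (cases "k \<le>o |?B|")
      case True
      show ?thesis by (rule coverable_mono[OF coverable_cardSuc[OF assms(6) lco k assms(2) B True] B])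
    next
      case False
      then have "|?B| \<le>o k" using not_ordLess[OF kco] ordLess_imp_ordLeq by blast
      then show ?thesis by (rule coverable_ordLeq[OF assms(2) _ lcinf])
    qed
  qed
  have "coverable k (Field l) l"
  proof (rule cofinality_cases[OF kco lcinf])
    assume *: "(\<exists>K\<subseteq>Field l. |K| <o k \<and> (\<forall>u\<in>Field l. \<exists>x\<in>K. (u, x) \<in> l)) \<or>
      (\<forall>X\<subseteq>Field l. |X| \<le>o k \<longrightarrow> (\<exists>b\<in>Field l. \<forall>x\<in>X. lt l x b))"
    show ?thesis by (rule coverable_Field[OF k lcinf _ *]) (rule cov)
  next
    fix X assume "X \<subseteq> Field l" "|X| \<le>o k" "\<And>u. u \<in> Field l \<Longrightarrow> \<exists>x\<in>X. (u, x) \<in> l"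
      and "\<And>X. X \<subseteq> Field l \<Longrightarrow> |X| <o k \<Longrightarrow> \<exists>b\<in>Field l. \<forall>x\<in>X. lt l x b"
    then have "cofinality l =o k" by (rule cofinality_eq[OF kco lcinf])
    then show ?thesis using assms(7) by blast
  qed
  then obtain X where X: "covers k (Field l) X" "|X| \<le>o l" unfolding coverable_def by blast
  let ?F = "{X. X \<subseteq> P_less (cardSuc k) (Field l) \<and>
         (\<forall>a \<in> P_less (cardSuc k) (Field l). \<exists>Q \<in> P_less k X. a \<subseteq> \<Union>Q)}"
  have small: "|a| <o cardSuc k \<longleftrightarrow> |a| \<le>o k" for a :: "'a set"
    using cardSuc_ordLeq_ordLess[OF kco card_of_Card_order] .
  have F: "?F = {X. covers k (Field l) X}"
    unfolding covers_def P_less_def small by auto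
  have XF: "X \<in> ?F" unfolding F using X(1) by simp
  then have ne: "?F \<noteq> {}" by blast
  have le: "cov l (cardSuc k) (cardSuc k) k \<le>o l"
    unfolding cov_def by (rule ordLeq_transitive[OF bspec[OF least_card(2)[OF ne] XF] X(2)])
  obtain Y where Y: "Y \<in> ?F" "cov l (cardSuc k) (cardSuc k) k = |Y|"
    using least_card(1)[OF ne] unfolding cov_def by blast
  have Yc: "covers k (Field l) Y" using Y(1) unfolding F by simp
  \<comment> \<open>Covering singletons forces the union of \<open>Y\<close> to be all of
    \<open>l\<close>, while its size is at most the larger of \<open>k\<close> and
    \<open>|Y|\<close>, both of which would be below \<open>l\<close>.\<close>
  have "\<not> |Y| <o l"
  proof
    assume Yl: "|Y| <o l"
    have "Field l \<subseteq> \<Union>Y"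
    proof
      fix x assume x: "x \<in> Field l"
      have "|{x}| \<le>o k" by (rule ordLess_imp_ordLeq[OF finite_ordLess[OF assms(2)]]) simp
      from conjunct2[OF Yc[unfolded covers_def], rule_format, OF _ this] x
      obtain Q where "Q \<subseteq> Y" "{x} \<subseteq> \<Union>Q" by auto
      then show "x \<in> \<Union>Y" by blast
    qed
    then have lU: "|Field l| \<le>o |\<Union>Y|" by (rule card_of_mono1)
    have Yk: "|y| \<le>o k" if "y \<in> Y" for y using Yc that unfolding covers_def by blast
    have "|\<Union>Y| <o l"
    proof (cases "|Y| \<le>o k")
      case True
      have "|\<Union>y\<in>Y. y| \<le>o k" by (rule UNION_ordLeq[OF kcinf True Yk])
      then show ?thesis using ordLeq_ordLess_trans[OF _ kl] by simp
    next
      case False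
      then have kY: "k \<le>o |Y|"
        using ordLeq_total[OF Card_order_wo[OF kco] Card_order_wo[OF card_of_Card_order]] by blast
      have Yinf: "Cinfinite |Y|" using cinfinite_mono[OF kY] kcinf card_of_Card_order by blast
      have "|\<Union>y\<in>Y. y| \<le>o |Y|"
        by (rule UNION_ordLeq[OF Yinf ordLeq_reflexive[OF Card_order_wo[OF card_of_Card_order]] ordLeq_transitive[OF Yk kY]])
      then show ?thesis using ordLeq_ordLess_trans[OF _ Yl] by simp
    qed
    then have "|Field l| <o l" by (rule ordLeq_ordLess_trans[OF lU])
    then show False using not_ordLess_ordIso[of "|Field l|" l] card_of_Field_ordIso[OF lco] by blast
  qed
  then have "l \<le>o cov l (cardSuc k) (cardSuc k) k" unfolding Y(2) by (simp add: not_ordLess[OF lco])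
  then show ?thesis using le by (simp add: ordIso_iff_ordLeq)
qed

end
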